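(* Let $G$ be a finite group, let $M$ be a semi-Mackey functor on $G$ and let $\mathscr{S}\subseteq M$ be a semi-Mackey subfunctor. (1) $\mathscr{S}^{-1}M=\{\mathscr{S}(X)^{-1}M(X)\}_{X\in\mathrm{Ob}({}_G\mathrm{set})}$ has a structure of a semi-Mackey functor induced from that on $M$, where $\mathscr{S}(X)^{-1}M(X)$ denotes the ordinary fraction (localization) of monoids. (2) The natural monoid homomorphisms $\ell_{\mathscr{S},X}\colon M(X)\to \mathscr{S}^{-1}M(X)$, $x\mapsto \frac{x}{1}$ (for all $X\in\mathrm{Ob}({}_G\mathrm{set})$) form a morphism of semi-Mackey functors $\ell_{\mathscr{S}}\colon M\to\mathscr{S}^{-1}M$. (3) For any semi-Mackey functor $M'$ on $G$, composition with $\ell_{\mathscr{S}}$ gives a bijection $$\mathrm{SMack}(G)(\mathscr{S}^{-1}M,M')\xrightarrow{\ \cong\ }\{\vartheta\in \mathrm{SMack}(G)(M,M')\mid \vartheta(\mathscr{S})\subseteq M'^{\times}\},\qquad \psi\mapsto\psi\circ\ell_{\mathscr{S}} .$$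
   Context: All monoids are commutative with unit; homomorphisms preserve units. $G$ is a finite group and ${}_G\mathrm{set}$ is the category of finite $G$-sets and $G$-equivariant maps. A semi-Mackey functor $M=(M^{\ast},M_{\ast})$ on $G$ consists of a contravariant functor $M^{\ast}$ and a covariant functor $M_{\ast}$ from ${}_G\mathrm{set}$ to sets such that: $M^{\ast}(X)=M_{\ast}(X)=:M(X)$ for each object $X$; for all $X,Y$ with inclusions $\iota_X,\iota_Y$ into $X\amalg Y$, the map $(M^{\ast}(\iota_X),M^{\ast}(\iota_Y))\colon M(X\amalg Y)\to M(X)\times M(Y)$ is bijective; and for every pullback square with $f\colon X\to Y$, $\eta\colon Y'\to Y$, $\xi\colon X'\to X$, $f'\colon X'\to Y'$ (so $f\xi=\eta f'$) one has $M^{\ast}(f)M_{\ast}(\eta)=M_{\ast}(\xi)M^{\ast}(f')$. Each $M(X)$ is then a monoid (multiplication: $M(X)\times M(X)\cong M(X\amalg X)\to M(X)$ via $M_\ast$ of the folding map; unit: the image of the unique element of $M(\emptyset)$), written multiplicatively, and $f^{\ast}:=M^{\ast}(f)$, $f_{\ast}:=M_{\ast}(f)$ are monoid homomorphisms. Morphisms of semi-Mackey functors are families of monoid homomorphisms natural for both $f^{\ast}$ and $f_{\ast}$; $\mathrm{SMack}(G)$ is the resulting category and $\mathrm{SMack}(G)(M,N)$ its hom-sets. A semi-Mackey subfunctor $\mathscr{S}\subseteq M$ is a family of submonoids $\mathscr{S}(X)\subseteq M(X)$ with $f^{\ast}(\mathscr{S}(Y))\subseteq\mathscr{S}(X)$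 and $f_{\ast}(\mathscr{S}(X))\subseteq\mathscr{S}(Y)$ for every $f\colon X\to Y$. $M^{\times}$ is the semi-Mackey subfunctor of $M$ with $M^{\times}(X)$ the group of invertible elements of $M(X)$. $\vartheta(\mathscr{S})\subseteq M'^{\times}$ means $\vartheta_X(\mathscr{S}(X))\subseteq M'^{\times}(X)$ for all $X$. The induced structure on $\mathscr{S}^{-1}M$ is given, for $f\colon X\to Y$, by $f^{\ast}(\frac{y}{t})=\frac{f^{\ast}(y)}{f^{\ast}(t)}$ and $f_{\ast}(\frac{x}{s})=\frac{f_{\ast}(x)}{f_{\ast}(s)}$. *)

theory Defs
  imports "HOL-Algebra.Group_Action" "HOL-Library.Infinite_Typeclass"
begin

section \<open>Finite \<open>G\<close>-sets\<close>

text \<open>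
  The underlying sets are finite subsets of a type \<open>'u\<close>, which will be required to be infinite
  (class \<open>infinite\<close>). For every such \<open>'u\<close> the resulting small category is equivalent to the
  category of all finite \<open>G\<close>-sets; in particular it has finite coproducts and pullbacks.
\<close>

record ('g, 'u) gset =
  points :: "'u set"
  act :: "'g \<Rightarrow> 'u \<Rightarrow> 'u"

text \<open>
  Actions are extensional in both arguments (in the second one because \<open>group_action\<close> is a
  homomorphism to \<open>BijGroup\<close>), so that a \<open>G\<close>-set is determined by its points and its action.
\<close>

definition fin_gsets :: "('g, 'b) monoid_scheme \<Rightarrow> ('g, 'u) gset set" where
  "fin_gsets G = {X. finite (points X) \<and> group_action G (points X) (act X)
                     \<and> act X \<in> extensional (carrier G)}"

definition gmaps :: "('g, 'b) monoid_scheme \<Rightarrow> ('g, 'u) gset \<Rightarrow> ('g, 'u) gset \<Rightarrow> ('u \<Rightarrow> 'u) set" where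
  "gmaps G X Y = {f \<in> points X \<rightarrow>\<^sub>E points Y.
     \<forall>g \<in> carrier G. \<forall>x \<in> points X. f (act X g x) = act Y g (f x)}"

definition gid :: "('g, 'u) gset \<Rightarrow> 'u \<Rightarrow> 'u" where
  "gid X = (\<lambda>x \<in> points X. x)"

definition gempty :: "('g, 'b) monoid_scheme \<Rightarrow> ('g, 'u) gset" where
  "gempty G = \<lparr>points = {}, act = (\<lambda>g \<in> carrier G. \<lambda>x \<in> {}. x)\<rparr>"

text \<open>
  \<open>Z\<close> is a disjoint union of \<open>X\<close> and \<open>Y\<close> with inclusions \<open>i\<close> and \<open>j\<close>. As the underlying sets
  live in a fixed type, disjoint unions are described up to isomorphism.
\<close>

definition is_coproduct ::
  "('g, 'b) monoid_scheme \<Rightarrow> ('g, 'u) gset \<Rightarrow> ('g, 'u) gset \<Rightarrow> ('g, 'u) gset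
    \<Rightarrow> ('u \<Rightarrow> 'u) \<Rightarrow> ('u \<Rightarrow> 'u) \<Rightarrow> bool" where
  "is_coproduct G X Y Z i j \<longleftrightarrow>
     Z \<in> fin_gsets G \<and> i \<in> gmaps G X Z \<and> j \<in> gmaps G Y Z
     \<and> inj_on i (points X) \<and> inj_on j (points Y)
     \<and> i ` points X \<inter> j ` points Y = {} \<and> i ` points X \<union> j ` points Y = points Z"

text \<open>
  The square with \<open>f: X \<rightarrow> Y\<close>, \<open>\<eta>: Y' \<rightarrow> Y\<close>, \<open>\<xi>: X' \<rightarrow> X\<close>, \<open>f': X' \<rightarrow> Y'\<close> is a pullback square.
\<close>

definition is_pullback ::
  "('g, 'b) monoid_scheme \<Rightarrow> ('g, 'u) gset \<Rightarrow> ('g, 'u) gset \<Rightarrow> ('g, 'u) gset \<Rightarrow> ('g, 'u) gset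
    \<Rightarrow> ('u \<Rightarrow> 'u) \<Rightarrow> ('u \<Rightarrow> 'u) \<Rightarrow> ('u \<Rightarrow> 'u) \<Rightarrow> ('u \<Rightarrow> 'u) \<Rightarrow> bool" where
  "is_pullback G X Y X' Y' f \<eta> \<xi> f' \<longleftrightarrow>
     X \<in> fin_gsets G \<and> Y \<in> fin_gsets G \<and> X' \<in> fin_gsets G \<and> Y' \<in> fin_gsets G
     \<and> f \<in> gmaps G X Y \<and> \<eta> \<in> gmaps G Y' Y \<and> \<xi> \<in> gmaps G X' X \<and> f' \<in> gmaps G X' Y'
     \<and> compose (points X') f \<xi> = compose (points X') \<eta> f'
     \<and> (\<forall>T \<in> fin_gsets G. \<forall>a \<in> gmaps G T X. \<forall>b \<in> gmaps G T Y'.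
          compose (points T) f a = compose (points T) \<eta> b \<longrightarrow>
          (\<exists>!h. h \<in> gmaps G T X' \<and> compose (points T) \<xi> h = a \<and> compose (points T) f' h = b))"


section \<open>Semi-Mackey functors\<close>

text \<open>
  For \<open>f: X \<rightarrow> Y\<close>, \<open>mpull M X Y f\<close> is \<open>M\<^sup>*(f): M(Y) \<rightarrow> M(X)\<close> and \<open>mpush M X Y f\<close> is the
  covariant \<open>M(X) \<rightarrow> M(Y)\<close>. The sharing of \<open>mobj\<close> expresses that both functors agree on objects.
\<close>

record ('g, 'u, 'm) mackey_data =
  mobj :: "('g, 'u) gset \<Rightarrow> 'm set"
  mpull :: "('g, 'u) gset \<Rightarrow> ('g, 'u) gset \<Rightarrow> ('u \<Rightarrow> 'u) \<Rightarrow> 'm \<Rightarrow> 'm"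
  mpush :: "('g, 'u) gset \<Rightarrow> ('g, 'u) gset \<Rightarrow> ('u \<Rightarrow> 'u) \<Rightarrow> 'm \<Rightarrow> 'm"

text \<open>
  Additivity for the empty disjoint union only says that \<open>M(\<emptyset>)\<close> has at most one element. The
  axiom \<open>empty\<close> excludes the functor that is empty everywhere; without it there would be no units.
\<close>

locale semi_mackey_functor =
  fixes G :: "('g, 'b) monoid_scheme" and M :: "('g, 'u::infinite, 'm) mackey_data"
  assumes pull_closed: "\<lbrakk>X \<in> fin_gsets G; Y \<in> fin_gsets G; f \<in> gmaps G X Y\<rbrakk>
      \<Longrightarrow> mpull M X Y f \<in> mobj M Y \<rightarrow> mobj M X"
    and pull_id: "\<lbrakk>X \<in> fin_gsets G; x \<in> mobj M X\<rbrakk> \<Longrightarrow> mpull M X X (gid X) x = x"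
    and pull_comp: "\<lbrakk>X \<in> fin_gsets G; Y \<in> fin_gsets G; Z \<in> fin_gsets G;
        f \<in> gmaps G X Y; g \<in> gmaps G Y Z; z \<in> mobj M Z\<rbrakk>
      \<Longrightarrow> mpull M X Z (compose (points X) g f) z = mpull M X Y f (mpull M Y Z g z)"
    and push_closed: "\<lbrakk>X \<in> fin_gsets G; Y \<in> fin_gsets G; f \<in> gmaps G X Y\<rbrakk>
      \<Longrightarrow> mpush M X Y f \<in> mobj M X \<rightarrow> mobj M Y"
    and push_id: "\<lbrakk>X \<in> fin_gsets G; x \<in> mobj M X\<rbrakk> \<Longrightarrow> mpush M X X (gid X) x = x"
    and push_comp: "\<lbrakk>X \<in> fin_gsets G; Y \<in> fin_gsets G; Z \<in> fin_gsets G;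
        f \<in> gmaps G X Y; g \<in> gmaps G Y Z; x \<in> mobj M X\<rbrakk>
      \<Longrightarrow> mpush M X Z (compose (points X) g f) x = mpush M Y Z g (mpush M X Y f x)"
    and additive: "\<lbrakk>X \<in> fin_gsets G; Y \<in> fin_gsets G; is_coproduct G X Y Z i j\<rbrakk>
      \<Longrightarrow> bij_betw (\<lambda>z. (mpull M X Z i z, mpull M Y Z j z)) (mobj M Z) (mobj M X \<times> mobj M Y)"
    and empty: "\<exists>!e. e \<in> mobj M (gempty G)"
    and mackey: "\<lbrakk>is_pullback G X Y X' Y' f \<eta> \<xi> f'; w \<in> mobj M Y'\<rbrakk>
      \<Longrightarrow> mpull M X Y f (mpush M Y' Y \<eta> w) = mpush M X' X \<xi> (mpull M X' Y' f' w)"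

text \<open>
  The monoid \<open>M(X)\<close>. The disjoint union \<open>X \<amalg> X\<close> is an arbitrarily chosen one, \<open>h\<close> below is the
  folding map, and the product of \<open>x\<close> and \<open>y\<close> is the push-forward along \<open>h\<close> of the element of
  \<open>M(X \<amalg> X)\<close> that corresponds to \<open>(x, y)\<close>.
\<close>

definition mackey_mult ::
  "('g, 'b) monoid_scheme \<Rightarrow> ('g, 'u, 'm) mackey_data \<Rightarrow> ('g, 'u) gset \<Rightarrow> 'm \<Rightarrow> 'm \<Rightarrow> 'm" where
  "mackey_mult G M X x y =
     (let (Z, i, j) = (SOME (Z, i, j). is_coproduct G X X Z i j);
          h = (THE h. h \<in> gmaps G Z X \<and> compose (points X) h i = gid X
                      \<and> compose (points X) h j = gid X)
      in mpush M Z X h (THE z. z \<in> mobj M Z \<and> mpull M X Z i z = x \<and> mpull M X Z j z = y))"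

definition mackey_one ::
  "('g, 'b) monoid_scheme \<Rightarrow> ('g, 'u, 'm) mackey_data \<Rightarrow> ('g, 'u) gset \<Rightarrow> 'm" where
  "mackey_one G M X = mpush M (gempty G) X (\<lambda>x \<in> {}. x) (THE e. e \<in> mobj M (gempty G))"

definition mackey_monoid ::
  "('g, 'b) monoid_scheme \<Rightarrow> ('g, 'u, 'm) mackey_data \<Rightarrow> ('g, 'u) gset \<Rightarrow> 'm monoid" where
  "mackey_monoid G M X =
     \<lparr>carrier = mobj M X, mult = mackey_mult G M X, one = mackey_one G M X\<rparr>"

definition mackey_units ::
  "('g, 'b) monoid_scheme \<Rightarrow> ('g, 'u, 'm) mackey_data \<Rightarrow> ('g, 'u) gset \<Rightarrow> 'm set" where
  "mackey_units G M X = Units (mackey_monoid G M X)"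

definition semi_mackey_subfunctor ::
  "('g, 'b) monoid_scheme \<Rightarrow> (('g, 'u) gset \<Rightarrow> 'm set) \<Rightarrow> ('g, 'u, 'm) mackey_data \<Rightarrow> bool" where
  "semi_mackey_subfunctor G S M \<longleftrightarrow>
     (\<forall>X \<in> fin_gsets G. submonoid (S X) (mackey_monoid G M X))
     \<and> (\<forall>X \<in> fin_gsets G. \<forall>Y \<in> fin_gsets G. \<forall>f \<in> gmaps G X Y.
          mpull M X Y f ` S Y \<subseteq> S X \<and> mpush M X Y f ` S X \<subseteq> S Y)"

text \<open>\<open>hom\<close> does not require preservation of the unit. Maps are extensional so that equality of
  morphisms is equality on the carriers.\<close>

definition monoid_homs :: "('a, 'c) monoid_scheme \<Rightarrow> ('b, 'd) monoid_scheme \<Rightarrow> ('a \<Rightarrow> 'b) set" where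
  "monoid_homs A B = {h \<in> hom A B. h \<one>\<^bsub>A\<^esub> = \<one>\<^bsub>B\<^esub> \<and> h \<in> extensional (carrier A)}"

definition smack ::
  "('g, 'b) monoid_scheme \<Rightarrow> ('g, 'u, 'm) mackey_data \<Rightarrow> ('g, 'u, 'n) mackey_data
    \<Rightarrow> (('g, 'u) gset \<Rightarrow> 'm \<Rightarrow> 'n) set" where
  "smack G M N = {\<theta> \<in> (\<Pi>\<^sub>E X \<in> fin_gsets G. monoid_homs (mackey_monoid G M X) (mackey_monoid G N X)).
     \<forall>X \<in> fin_gsets G. \<forall>Y \<in> fin_gsets G. \<forall>f \<in> gmaps G X Y.
       (\<forall>y \<in> mobj M Y. \<theta> X (mpull M X Y f y) = mpull N X Y f (\<theta> Y y))
       \<and> (\<forall>x \<in> mobj M X. \<theta> Y (mpush M X Y f x) = mpush N X Y f (\<theta> X x))}"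

definition smack_comp ::
  "('g, 'b) monoid_scheme \<Rightarrow> ('g, 'u, 'm) mackey_data \<Rightarrow> (('g, 'u) gset \<Rightarrow> 'n \<Rightarrow> 'k)
    \<Rightarrow> (('g, 'u) gset \<Rightarrow> 'm \<Rightarrow> 'n) \<Rightarrow> ('g, 'u) gset \<Rightarrow> 'm \<Rightarrow> 'k" where
  "smack_comp G M \<psi> \<phi> = (\<lambda>X \<in> fin_gsets G. compose (mobj M X) (\<psi> X) (\<phi> X))"


section \<open>Fractions of commutative monoids\<close>

definition frac_rel :: "('a, 'c) monoid_scheme \<Rightarrow> 'a set \<Rightarrow> (('a \<times> 'a) \<times> ('a \<times> 'a)) set" where
  "frac_rel A S = {((x, s), (y, t)). x \<in> carrier A \<and> s \<in> S \<and> y \<in> carrier A \<and> t \<in> S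
     \<and> (\<exists>u \<in> S. u \<otimes>\<^bsub>A\<^esub> (t \<otimes>\<^bsub>A\<^esub> x) = u \<otimes>\<^bsub>A\<^esub> (s \<otimes>\<^bsub>A\<^esub> y))}"

definition frac :: "('a, 'c) monoid_scheme \<Rightarrow> 'a set \<Rightarrow> 'a \<Rightarrow> 'a \<Rightarrow> ('a \<times> 'a) set" where
  "frac A S x s = frac_rel A S `` {(x, s)}"

text \<open>
  Operations on fractions are unions over all representatives; when the operation is well defined,
  all members of the union coincide (cf. \<open>UN_equiv_class\<close>).
\<close>

definition frac_monoid :: "('a, 'c) monoid_scheme \<Rightarrow> 'a set \<Rightarrow> ('a \<times> 'a) set monoid" where
  "frac_monoid A S =
     \<lparr>carrier = (carrier A \<times> S) // frac_rel A S,
      mult = (\<lambda>c d. \<Union>(x, s) \<in> c. \<Union>(y, t) \<in> d. frac A S (x \<otimes>\<^bsub>A\<^esub> y) (s \<otimes>\<^bsub>A\<^esub> t)),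
      one = frac A S \<one>\<^bsub>A\<^esub> \<one>\<^bsub>A\<^esub>\<rparr>"


section \<open>Fractions of semi-Mackey functors\<close>

definition mackey_frac ::
  "('g, 'b) monoid_scheme \<Rightarrow> ('g, 'u, 'm) mackey_data \<Rightarrow> (('g, 'u) gset \<Rightarrow> 'm set)
    \<Rightarrow> ('g, 'u) gset \<Rightarrow> 'm \<Rightarrow> 'm \<Rightarrow> ('m \<times> 'm) set" where
  "mackey_frac G M S X = frac (mackey_monoid G M X) (S X)"

definition mackey_loc ::
  "('g, 'b) monoid_scheme \<Rightarrow> ('g, 'u, 'm) mackey_data \<Rightarrow> (('g, 'u) gset \<Rightarrow> 'm set)
    \<Rightarrow> ('g, 'u, ('m \<times> 'm) set) mackey_data" where
  "mackey_loc G M S =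
     \<lparr>mobj = (\<lambda>X. carrier (frac_monoid (mackey_monoid G M X) (S X))),
      mpull = (\<lambda>X Y f c. \<Union>(y, t) \<in> c. mackey_frac G M S X (mpull M X Y f y) (mpull M X Y f t)),
      mpush = (\<lambda>X Y f c. \<Union>(x, s) \<in> c. mackey_frac G M S Y (mpush M X Y f x) (mpush M X Y f s))\<rparr>"

definition loc_map ::
  "('g, 'b) monoid_scheme \<Rightarrow> ('g, 'u, 'm) mackey_data \<Rightarrow> (('g, 'u) gset \<Rightarrow> 'm set)
    \<Rightarrow> ('g, 'u) gset \<Rightarrow> 'm \<Rightarrow> ('m \<times> 'm) set" where
  "loc_map G M S = (\<lambda>X \<in> fin_gsets G. \<lambda>x \<in> mobj M X. mackey_frac G M S X x (mackey_one G M X))"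

end

theory Submission
  imports Defs
begin

text \<open>
  The product in \<open>M(X)\<close> is only given through a disjoint union \<open>X \<amalg> X\<close>, its codiagonal and
  additivity. Everything about it follows from one formula, \<open>push_coproduct\<close>: for \<open>h: X \<amalg> Y \<rightarrow> W\<close>
  with restrictions \<open>h i\<close> and \<open>h j\<close> to the summands,
  \<open>h\<^sub>* z = (h i)\<^sub>*(i\<^sup>* z) \<cdot> (h j)\<^sub>*(j\<^sup>* z)\<close>.
  It is an instance of the Mackey condition, because the square formed by a summand \<open>X \<rightarrow> X \<amalg> Y\<close> and
  a map \<open>p \<amalg> q\<close> is a pullback. The formula makes every \<open>M(X)\<close> a commutative monoid and every \<open>f\<^sub>*\<close> a
  homomorphism; \<open>f\<^sup>*\<close> is one because the naturality square of the codiagonal is a pullback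
  (\<open>codiagonal_pullback\<close>). All this holds for any semi-Mackey functor, hence is available for \<open>M\<close>,
  for the target \<open>M'\<close> and, once it is known to be one, for \<open>S\<^sup>-\<^sup>1M\<close>.

  Since \<open>f\<^sup>*\<close> and \<open>f\<^sub>*\<close> are homomorphisms that preserve \<open>S\<close>, they induce maps of fractions, and
  functoriality and the Mackey condition are inherited representative by representative. The
  axiom that needs an argument is additivity of \<open>S\<^sup>-\<^sup>1M\<close> (\<open>loc_additive\<close>): denominators on \<open>X\<close> and \<open>Y\<close>
  have to be combined into a denominator on \<open>X \<amalg> Y\<close>, which works because the formula for \<open>h = id\<close>
  shows that \<open>S\<close> is itself additive (\<open>denominator_coproduct\<close>). Lifting numerators and denominators
  to \<open>X \<amalg> X\<close> then identifies the product of \<open>S\<^sup>-\<^sup>1M(X)\<close> as a semi-Mackey functor with the product of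
  fractions (\<open>loc_mult\<close>).

  The universal property holds for each \<open>X\<close> by the universal property of fractions of monoids. It
  is compatible with \<open>f\<^sup>*\<close> and \<open>f\<^sub>*\<close> since a homomorphism out of \<open>S(X)\<^sup>-\<^sup>1M(X)\<close> under which the
  denominators become invertible is determined by its values at the fractions \<open>x / 1\<close>
  (\<open>loc_hom_unique\<close>, \<open>smack_extend\<close>).
\<close>

section \<open>Finite \<open>G\<close>-sets\<close>

lemma gset_act:
  assumes "X \<in> fin_gsets G" "x \<in> points X"
  shows gset_act_closed: "g \<in> carrier G \<Longrightarrow> act X g x \<in> points X"
    and gset_act_one: "act X \<one>\<^bsub>G\<^esub> x = x"
    and gset_act_mult: "\<lbrakk>g \<in> carrier G; h \<in> carrier G\<rbrakk>
      \<Longrightarrow> act X (g \<otimes>\<^bsub>G\<^esub> h) x = act X g (act X h x)"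
proof -
  interpret group_action G "points X" "act X"
    using assms(1) by (simp add: fin_gsets_def)
  show "g \<in> carrier G \<Longrightarrow> act X g x \<in> points X"
    using element_image assms(2) by blast
  show "act X \<one>\<^bsub>G\<^esub> x = x"
    using id_eq_one assms(2) by (metis restrict_apply')
  show "\<lbrakk>g \<in> carrier G; h \<in> carrier G\<rbrakk> \<Longrightarrow> act X (g \<otimes>\<^bsub>G\<^esub> h) x = act X g (act X h x)"
    using composition_rule assms(2) by blast
qed

lemma (in group) fin_gsetI:
  assumes "finite P" "a \<in> extensional (carrier G)"
    and "\<And>g. g \<in> carrier G \<Longrightarrow> a g \<in> P \<rightarrow>\<^sub>E P"
    and one: "\<And>x. x \<in> P \<Longrightarrow> a \<one> x = x"
    and mult: "\<And>g h x. \<lbrakk>g \<in> carrier G; h \<in> carrier G; x \<in> P\<rbrakk> \<Longrightarrow> a (g \<otimes> h) x = a g (a h x)"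
  shows "\<lparr>points = P, act = a\<rparr> \<in> fin_gsets G"
proof -
  have closed: "a g x \<in> P" if "g \<in> carrier G" "x \<in> P" for g x
    using assms(3) that by blast
  have bij: "a g \<in> Bij P" if g: "g \<in> carrier G" for g
  proof -
    have "a (inv g) (a g x) = x" "a g (a (inv g) x) = x" if "x \<in> P" for x
      using that g mult[of "inv g" g x] mult[of g "inv g" x] one by simp_all
    then have "bij_betw (a g) P P"
      using g closed by (intro bij_betw_byWitness[where f' = "a (inv g)"]) auto
    then show ?thesis
      using assms(3)[OF g] by (auto simp: Bij_def PiE_def)
  qed
  have "a (g \<otimes> h) = a g \<otimes>\<^bsub>BijGroup P\<^esub> a h" if gh: "g \<in> carrier G" "h \<in> carrier G" for g h
    using gh bij mult assms(3)[of "g \<otimes> h"]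
    by (auto simp: BijGroup_def compose_def PiE_def intro!: extensionalityI[of _ P])
  then have "a \<in> hom G (BijGroup P)"
    using bij by (auto simp: hom_def BijGroup_def)
  then have "group_action G P a"
    by (simp add: group_action_def group_hom_def group_hom_axioms_def group_BijGroup)
  then show ?thesis
    using assms by (simp add: fin_gsets_def)
qed

lemma compose_eqD: "compose A f g = h \<Longrightarrow> x \<in> A \<Longrightarrow> f (g x) = h x"
  by (auto simp: compose_def)

lemma gmaps_extensional: "f \<in> gmaps G X Y \<Longrightarrow> f \<in> extensional (points X)"
  by (auto simp: gmaps_def PiE_def)

lemma gmaps_closed: "\<lbrakk>f \<in> gmaps G X Y; x \<in> points X\<rbrakk> \<Longrightarrow> f x \<in> points Y"
  by (auto simp: gmaps_def)

lemma gmaps_equivariant: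
  "\<lbrakk>f \<in> gmaps G X Y; g \<in> carrier G; x \<in> points X\<rbrakk> \<Longrightarrow> f (act X g x) = act Y g (f x)"
  by (auto simp: gmaps_def)

lemma gmaps_eqI:
  "\<lbrakk>f \<in> gmaps G X Y; f' \<in> gmaps G X Y; \<And>x. x \<in> points X \<Longrightarrow> f x = f' x\<rbrakk> \<Longrightarrow> f = f'"
  by (auto simp: gmaps_def PiE_def intro: extensionalityI)

lemma gmaps_compose:
  "\<lbrakk>X \<in> fin_gsets G; f \<in> gmaps G X Y; g \<in> gmaps G Y Z\<rbrakk> \<Longrightarrow> compose (points X) g f \<in> gmaps G X Z"
  by (auto simp: gmaps_def compose_def gset_act_closed PiE_iff)

lemma gid_gmaps: "X \<in> fin_gsets G \<Longrightarrow> gid X \<in> gmaps G X X"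
  by (auto simp: gmaps_def gid_def gset_act_closed)

lemma gid_apply: "x \<in> points X \<Longrightarrow> gid X x = x"
  by (simp add: gid_def)

lemma compose_gid:
  assumes "f \<in> gmaps G X Y"
  shows compose_gid_left: "compose (points X) (gid Y) f = f"
    and compose_gid_right: "compose (points X) f (gid X) = f"
  using assms by (auto simp: gmaps_def compose_def gid_def PiE_iff extensional_def fun_eq_iff)

lemma gmaps_compose_assoc:
  "f \<in> gmaps G X Y \<Longrightarrow>
    compose (points X) (compose (points Y) k h) f = compose (points X) k (compose (points X) h f)"
  by (auto simp: compose_def gmaps_closed fun_eq_iff)

lemma (in group) gempty_fin_gset: "gempty G \<in> fin_gsets G"
  unfolding gempty_def by (rule fin_gsetI) auto

lemma gempty_gmaps: "(\<lambda>x \<in> {}. x) \<in> gmaps G (gempty G) X"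
  by (auto simp: gmaps_def gempty_def)

lemma compose_gempty: "compose (points (gempty G)) f g = (\<lambda>x \<in> {}. x)"
  by (auto simp: gempty_def compose_def)

subsection \<open>Disjoint unions\<close>

lemma coproduct_gset: "is_coproduct G X Y Z i j \<Longrightarrow> Z \<in> fin_gsets G"
  and coproduct_left: "is_coproduct G X Y Z i j \<Longrightarrow> i \<in> gmaps G X Z"
  and coproduct_right: "is_coproduct G X Y Z i j \<Longrightarrow> j \<in> gmaps G Y Z"
  by (simp_all add: is_coproduct_def)

lemma is_coproduct_sym: "is_coproduct G X Y Z i j \<Longrightarrow> is_coproduct G Y X Z j i"
  by (auto simp: is_coproduct_def)

lemma is_coproduct_gempty:
  "X \<in> fin_gsets G \<Longrightarrow> is_coproduct G X (gempty G) X (gid X) (\<lambda>x \<in> {}. x)"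
  using gempty_gmaps[of G X]
  by (auto simp: is_coproduct_def gid_gmaps gid_apply inj_on_def image_iff)
     (auto simp: gempty_def gid_apply)

text \<open>
  The ambient type is infinite, so it has room for a copy of the disjoint sum of any two finite
  sets; the action is transported along a bijection onto that copy.
\<close>

lemma (in group) coproduct_exists:
  fixes X Y :: "('a, 'u::infinite) gset"
  assumes X: "X \<in> fin_gsets G" and Y: "Y \<in> fin_gsets G"
  obtains Z i j where "is_coproduct G X Y Z i j"
proof -
  let ?D = "points X <+> points Y"
  have fin: "finite ?D"
    using X Y by (simp add: fin_gsets_def)
  obtain P :: "'u set" where P: "finite P" "card P = card ?D"
    using infinite_arbitrarily_large[OF infinite_UNIV] by blast
  obtain e where e: "bij_betw e ?D P"
    using finite_same_card_bij[OF fin P(1)] P(2) by auto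
  let ?d = "inv_into ?D e"
  let ?s = "\<lambda>g. map_sum (act X g) (act Y g)"
  let ?a = "\<lambda>g \<in> carrier G. \<lambda>z \<in> P. e (?s g (?d z))"
  let ?Z = "\<lparr>points = P, act = ?a\<rparr>"
  have dP: "?d z \<in> ?D" and ed: "e (?d z) = z" if "z \<in> P" for z
    using e that by (auto simp: bij_betw_def inv_into_into f_inv_into_f)
  have de: "?d (e w) = w" and eP: "e w \<in> P" if "w \<in> ?D" for w
    using e that by (auto simp: bij_betw_def)
  have sD: "?s g w \<in> ?D" if "g \<in> carrier G" "w \<in> ?D" for g w
    using that X Y by (auto simp: gset_act_closed)
  have s1: "?s \<one> w = w" if "w \<in> ?D" for w
    using that gset_act_one[OF X] gset_act_one[OF Y] by auto
  have s2: "?s (g \<otimes> h) w = ?s g (?s h w)" if "g \<in> carrier G" "h \<in> carrier G" "w \<in> ?D" for g h w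
    using that gset_act_mult[OF X] gset_act_mult[OF Y] by auto
  have Z: "?Z \<in> fin_gsets G"
    by (rule fin_gsetI) (use P dP ed de eP sD s1 s2 in auto)
  have inj: "inj_on e ?D"
    using e by (simp add: bij_betw_def)
  have i: "(\<lambda>x \<in> points X. e (Inl x)) \<in> gmaps G X ?Z"
    using eP X by (auto simp: gmaps_def gset_act_closed de InlI)
  have j: "(\<lambda>y \<in> points Y. e (Inr y)) \<in> gmaps G Y ?Z"
    using eP Y by (auto simp: gmaps_def gset_act_closed de InrI)
  have img: "P = e ` ?D"
    using e by (simp add: bij_betw_def)
  have "is_coproduct G X Y ?Z (\<lambda>x \<in> points X. e (Inl x)) (\<lambda>y \<in> points Y. e (Inr y))"
    unfolding is_coproduct_def using Z i j img
    by (auto simp: inj_on_def dest: inj_onD[OF inj])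
  then show ?thesis
    using that by blast
qed

lemma coproduct_cases:
  assumes "is_coproduct G X Y Z i j" "z \<in> points Z"
  obtains x where "x \<in> points X" "z = i x" | y where "y \<in> points Y" "z = j y"
  using assms unfolding is_coproduct_def by blast

lemma coproduct_distinct:
  assumes "is_coproduct G X Y Z i j" "x \<in> points X" "y \<in> points Y"
  shows "i x \<noteq> j y"
  using assms by (auto simp: is_coproduct_def)

lemma coproduct_inj:
  assumes "is_coproduct G X Y Z i j"
  shows coproduct_inj_left: "\<lbrakk>x \<in> points X; x' \<in> points X\<rbrakk> \<Longrightarrow> i x = i x' \<longleftrightarrow> x = x'"
    and coproduct_inj_right: "\<lbrakk>y \<in> points Y; y' \<in> points Y\<rbrakk> \<Longrightarrow> j y = j y' \<longleftrightarrow> y = y'"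
  using assms by (auto simp: is_coproduct_def inj_on_def)

lemma coproduct_map_eqI:
  assumes "is_coproduct G X Y Z i j" "h \<in> gmaps G Z W" "h' \<in> gmaps G Z W"
    and "\<And>x. x \<in> points X \<Longrightarrow> h (i x) = h' (i x)" "\<And>y. y \<in> points Y \<Longrightarrow> h (j y) = h' (j y)"
  shows "h = h'"
  using assms(2,3)
proof (rule gmaps_eqI)
  fix z assume "z \<in> points Z"
  with assms(1) show "h z = h' z"
    by (cases rule: coproduct_cases) (simp_all add: assms(4,5))
qed

lemma coproduct_copair:
  assumes X: "X \<in> fin_gsets G" and Y: "Y \<in> fin_gsets G" and Z: "is_coproduct G X Y Z i j"
    and f: "f \<in> gmaps G X W" and g: "g \<in> gmaps G Y W"
  obtains h where "h \<in> gmaps G Z W" "compose (points X) h i = f" "compose (points Y) h j = g"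
proof
  define h where "h = (\<lambda>z \<in> points Z. if z \<in> i ` points X then f (inv_into (points X) i z)
              else g (inv_into (points Y) j z))"
  have i: "i \<in> gmaps G X Z" and j: "j \<in> gmaps G Y Z"
    using Z by (simp_all add: is_coproduct_def)
  have hi: "h (i x) = f x" if "x \<in> points X" for x
    using that Z gmaps_closed[OF i that] by (auto simp: h_def is_coproduct_def)
  have hj: "h (j y) = g y" if "y \<in> points Y" for y
    using that Z gmaps_closed[OF j that] by (auto simp: h_def is_coproduct_def)
  have "h z \<in> points W \<and> (\<forall>a \<in> carrier G. h (act Z a z) = act W a (h z))"
    if "z \<in> points Z" for z
    using Z that
  proof (cases rule: coproduct_cases)
    case (1 x)
    have "h (act Z a (i x)) = act W a (f x)" if "a \<in> carrier G" for a
      using 1(1) that hi[of "act X a x"] gset_act_closed[OF X]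
      by (simp add: gmaps_equivariant[OF i, symmetric] gmaps_equivariant[OF f])
    then show ?thesis
      using 1 hi gmaps_closed[OF f] by simp
  next
    case (2 y)
    have "h (act Z a (j y)) = act W a (g y)" if "a \<in> carrier G" for a
      using 2(1) that hj[of "act Y a y"] gset_act_closed[OF Y]
      by (simp add: gmaps_equivariant[OF j, symmetric] gmaps_equivariant[OF g])
    then show ?thesis
      using 2 hj gmaps_closed[OF g] by simp
  qed
  then show "h \<in> gmaps G Z W"
    by (auto simp: gmaps_def h_def)
  show "compose (points X) h i = f"
    using gmaps_extensional[OF f] hi by (intro extensionalityI[of _ "points X"]) (auto simp: compose_eq)
  show "compose (points Y) h j = g"
    using gmaps_extensional[OF g] hj by (intro extensionalityI[of _ "points Y"]) (auto simp: compose_eq)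
qed

subsection \<open>Pullback squares\<close>

text \<open>
  A square is a pullback as soon as it is one on points: a cone determines its mediating map point
  by point, and the uniqueness of these points forces the mediating map to be equivariant. In this
  way the Mackey condition becomes available for concrete squares.
\<close>

lemma is_pullbackI:
  assumes X': "X' \<in> fin_gsets G" and fin: "X \<in> fin_gsets G" "Y \<in> fin_gsets G" "Y' \<in> fin_gsets G"
    and maps: "f \<in> gmaps G X Y" "\<eta> \<in> gmaps G Y' Y"
    and xi: "\<xi> \<in> gmaps G X' X" and f': "f' \<in> gmaps G X' Y'"
    and commute: "\<And>x. x \<in> points X' \<Longrightarrow> f (\<xi> x) = \<eta> (f' x)"
    and fibre: "\<And>x y. \<lbrakk>x \<in> points X; y \<in> points Y'; f x = \<eta> y\<rbrakk>
      \<Longrightarrow> \<exists>!w. w \<in> points X' \<and> \<xi> w = x \<and> f' w = y"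
  shows "is_pullback G X Y X' Y' f \<eta> \<xi> f'"
  unfolding is_pullback_def
proof (intro conjI ballI impI)
  show "compose (points X') f \<xi> = compose (points X') \<eta> f'"
    using commute by (auto simp: compose_def)
next
  fix T a b
  assume T: "T \<in> fin_gsets G" and a: "a \<in> gmaps G T X" and b: "b \<in> gmaps G T Y'"
    and "compose (points T) f a = compose (points T) \<eta> b"
  then have eq: "f (a t) = \<eta> (b t)" if "t \<in> points T" for t
    using compose_eqD[of "points T" f a, OF _ that] compose_eq that by metis
  define h where "h = (\<lambda>t \<in> points T. THE w. w \<in> points X' \<and> \<xi> w = a t \<and> f' w = b t)"
  have ex1: "\<exists>!w. w \<in> points X' \<and> \<xi> w = a t \<and> f' w = b t" if "t \<in> points T" for t
    using that fibre gmaps_closed[OF a] gmaps_closed[OF b] eq by blast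
  have h: "h t \<in> points X'" "\<xi> (h t) = a t" "f' (h t) = b t" if "t \<in> points T" for t
    using theI'[OF ex1[OF that]] that by (auto simp: h_def)
  have "h (act T g t) = act X' g (h t)" if "g \<in> carrier G" "t \<in> points T" for g t
  proof -
    have gt: "act T g t \<in> points T"
      by (rule gset_act_closed[OF T that(2,1)])
    have "act X' g (h t) \<in> points X'" "\<xi> (act X' g (h t)) = a (act T g t)"
      "f' (act X' g (h t)) = b (act T g t)"
      using gset_act_closed[OF X' h(1) that(1)] gmaps_equivariant[OF xi that(1) h(1)]
        gmaps_equivariant[OF f' that(1) h(1)] gmaps_equivariant[OF a that]
        gmaps_equivariant[OF b that] h[OF that(2)] that by simp_all
    then show ?thesis
      using ex1[OF gt] h[OF gt] by metis
  qed
  moreover have "h \<in> extensional (points T)"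
    by (simp add: h_def)
  ultimately have hm: "h \<in> gmaps G T X'"
    using h(1) by (simp add: gmaps_def PiE_def)
  show "\<exists>!h. h \<in> gmaps G T X' \<and> compose (points T) \<xi> h = a \<and> compose (points T) f' h = b"
  proof (intro ex1I conjI)
    show "compose (points T) \<xi> h = a" "compose (points T) f' h = b"
      using h gmaps_extensional[OF a] gmaps_extensional[OF b]
      by (auto simp: compose_eq intro: extensionalityI[of _ "points T"])
    fix h' assume h': "h' \<in> gmaps G T X' \<and> compose (points T) \<xi> h' = a \<and> compose (points T) f' h' = b"
    show "h' = h"
    proof (rule gmaps_eqI)
      fix t assume t: "t \<in> points T"
      then have "\<xi> (h' t) = a t" "f' (h' t) = b t" "h' t \<in> points X'"
        using compose_eqD[of "points T" \<xi> h' a] compose_eqD[of "points T" f' h' b]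
          gmaps_closed[of h' G T X'] h' by simp_all
      then show "h' t = h t"
        using ex1[OF t] h[OF t] by metis
    qed (use h' hm in auto)
  qed (rule hm)
qed (fact assms)+

text \<open>
  For \<open>k = p \<amalg> q\<close>, the preimage under \<open>k\<close> of the first summand of the target is exactly the first
  summand of the source.
\<close>

lemma coproduct_summand_pullback:
  assumes fin: "X \<in> fin_gsets G" "W \<in> fin_gsets G"
    and Z: "is_coproduct G X Y Z i j" and V: "is_coproduct G W W' V a b"
    and p: "p \<in> gmaps G X W" and q: "q \<in> gmaps G Y W'" and k: "k \<in> gmaps G Z V"
    and ki: "compose (points X) k i = compose (points X) a p"
    and kj: "compose (points Y) k j = compose (points Y) b q"
  shows "is_pullback G W V X Z a k p i"
proof (rule is_pullbackI)
  have ki': "k (i x) = a (p x)" if "x \<in> points X" for x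
    using compose_eqD[OF ki that] that by (simp add: compose_eq)
  have kj': "k (j y) = b (q y)" if "y \<in> points Y" for y
    using compose_eqD[OF kj that] that by (simp add: compose_eq)
  show "a (p x) = k (i x)" if "x \<in> points X" for x
    using ki'[OF that] by simp
  show "\<exists>!x. x \<in> points X \<and> p x = w \<and> i x = z"
    if w: "w \<in> points W" and z: "z \<in> points Z" and eq: "a w = k z" for w z
    using Z z
  proof (cases rule: coproduct_cases)
    case (1 x)
    then have "p x = w"
      using eq ki' coproduct_inj_left[OF V w gmaps_closed[OF p]] by auto
    then show ?thesis
      using 1 coproduct_inj_left[OF Z] by metis
  next
    case (2 y)
    then show ?thesis
      using eq kj' coproduct_distinct[OF V w gmaps_closed[OF q]] by auto
  qed
qed (fact fin k p coproduct_gset[OF Z] coproduct_gset[OF V] coproduct_left[OF Z] coproduct_left[OF V])+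

text \<open>
  The codiagonal is natural, and its naturality square for \<open>f: X \<rightarrow> Y\<close> is cartesian: over \<open>x\<close>, both
  codiagonals have two points, one for each copy, and \<open>f \<amalg> f\<close> preserves the copies.
\<close>

lemma codiagonal_pullback:
  assumes fin: "X \<in> fin_gsets G" "Y \<in> fin_gsets G"
    and Z: "is_coproduct G X X Z i j" and V: "is_coproduct G Y Y V a b"
    and f: "f \<in> gmaps G X Y" and k: "k \<in> gmaps G Z V"
    and ki: "compose (points X) k i = compose (points X) a f"
    and kj: "compose (points X) k j = compose (points X) b f"
    and h: "h \<in> gmaps G Z X" "compose (points X) h i = gid X" "compose (points X) h j = gid X"
    and m: "m \<in> gmaps G V Y" "compose (points Y) m a = gid Y" "compose (points Y) m b = gid Y"
  shows "is_pullback G X Y Z V f m h k"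
proof (rule is_pullbackI)
  have k': "k (i x) = a (f x)" "k (j x) = b (f x)" if "x \<in> points X" for x
    using compose_eqD[OF ki that] compose_eqD[OF kj that] that by (simp_all add: compose_eq)
  have h': "h (i x) = x" "h (j x) = x" if "x \<in> points X" for x
    using compose_eqD[OF h(2) that] compose_eqD[OF h(3) that] that by (simp_all add: gid_apply)
  have m': "m (a y) = y" "m (b y) = y" if "y \<in> points Y" for y
    using compose_eqD[OF m(2) that] compose_eqD[OF m(3) that] that by (simp_all add: gid_apply)
  show "f (h z) = m (k z)" if "z \<in> points Z" for z
    using Z that by (cases rule: coproduct_cases) (simp_all add: gmaps_closed[OF f] h' k' m')
  show "\<exists>!z. z \<in> points Z \<and> h z = x \<and> k z = v"
    if x: "x \<in> points X" and v: "v \<in> points V" and eq: "f x = m v" for x v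
  proof -
    have fx: "f x \<in> points Y"
      using x gmaps_closed[OF f] by blast
    have unique: "z = i x \<and> v = a (f x) \<or> z = j x \<and> v = b (f x)"
      if z: "z \<in> points Z" "h z = x \<and> k z = v" for z
      using Z z(1) by (cases rule: coproduct_cases) (use z(2) in \<open>auto simp: h' k'\<close>)
    have ij: "i x \<in> points Z" "j x \<in> points Z"
      using coproduct_left[OF Z] coproduct_right[OF Z] x gmaps_closed by metis+
    have ne: "a (f x) \<noteq> b (f x)"
      using coproduct_distinct[OF V fx fx] .
    show ?thesis
      using V v
    proof (cases rule: coproduct_cases)
      case (1 y)
      then have v: "v = a (f x)"
        using eq by (simp add: m')
      show ?thesis
      proof (rule ex1I)
        show "i x \<in> points Z \<and> h (i x) = x \<and> k (i x) = v"
          using ij h'[OF x] k'[OF x] v by simp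
        show "z = i x" if "z \<in> points Z \<and> h z = x \<and> k z = v" for z
          using unique[of z] that ne v by metis
      qed
    next
      case (2 y)
      then have v: "v = b (f x)"
        using eq by (simp add: m')
      show ?thesis
      proof (rule ex1I)
        show "j x \<in> points Z \<and> h (j x) = x \<and> k (j x) = v"
          using ij h'[OF x] k'[OF x] v by simp
        show "z = j x" if "z \<in> points Z \<and> h z = x \<and> k z = v" for z
          using unique[of z] that ne v by metis
      qed
    qed
  qed
qed (fact fin h m k f coproduct_gset[OF Z] coproduct_gset[OF V])+

lemma (in group) gempty_pullback:
  assumes "X \<in> fin_gsets G" "Y \<in> fin_gsets G" "f \<in> gmaps G X Y"
  shows "is_pullback G X Y (gempty G) (gempty G) f (\<lambda>x \<in> {}. x) (\<lambda>x \<in> {}. x) (gid (gempty G))"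
proof (rule is_pullbackI)
  show "gempty G \<in> fin_gsets G" "gempty G \<in> fin_gsets G"
    by (rule gempty_fin_gset)+
  show "gid (gempty G) \<in> gmaps G (gempty G) (gempty G)"
    using gempty_fin_gset by (rule gid_gmaps)
qed (fact assms gempty_gmaps | simp add: gempty_def)+

section \<open>The monoids of a semi-Mackey functor\<close>

locale group_semi_mackey = group G + semi_mackey_functor G M
  for G :: "('g, 'b) monoid_scheme" (structure) and M :: "('g, 'u::infinite, 'm) mackey_data"
begin

abbreviation mon :: "('g, 'u) gset \<Rightarrow> 'm monoid" where
  "mon X \<equiv> mackey_monoid G M X"

lemma mon_simps: "carrier (mon X) = mobj M X" "x \<otimes>\<^bsub>mon X\<^esub> y = mackey_mult G M X x y"
  "\<one>\<^bsub>mon X\<^esub> = mackey_one G M X"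
  by (simp_all add: mackey_monoid_def)

lemma pull_in: "\<lbrakk>X \<in> fin_gsets G; Y \<in> fin_gsets G; f \<in> gmaps G X Y; y \<in> mobj M Y\<rbrakk>
    \<Longrightarrow> mpull M X Y f y \<in> mobj M X"
  using pull_closed by blast

lemma push_in: "\<lbrakk>X \<in> fin_gsets G; Y \<in> fin_gsets G; f \<in> gmaps G X Y; x \<in> mobj M X\<rbrakk>
    \<Longrightarrow> mpush M X Y f x \<in> mobj M Y"
  using push_closed by blast

lemma coproduct_element:
  assumes "X \<in> fin_gsets G" "Y \<in> fin_gsets G" "is_coproduct G X Y Z i j" "x \<in> mobj M X" "y \<in> mobj M Y"
  obtains z where "z \<in> mobj M Z" "mpull M X Z i z = x" "mpull M Y Z j z = y"
proof -
  have "(x, y) \<in> (\<lambda>z. (mpull M X Z i z, mpull M Y Z j z)) ` mobj M Z"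
    using additive[OF assms(1-3)] assms(4,5) by (simp add: bij_betw_def)
  then show ?thesis
    using that by auto
qed

lemma coproduct_element_eqI:
  assumes "X \<in> fin_gsets G" "Y \<in> fin_gsets G" "is_coproduct G X Y Z i j" "z \<in> mobj M Z" "z' \<in> mobj M Z"
    and "mpull M X Z i z = mpull M X Z i z'" "mpull M Y Z j z = mpull M Y Z j z'"
  shows "z = z'"
  using bij_betw_imp_inj_on[OF additive[OF assms(1-3)]] assms(4-) by (simp add: inj_on_def)

text \<open>
  Pushing forward out of a disjoint union is the product of the push-forwards from the two summands:
  writing \<open>h: X \<amalg> Y \<rightarrow> W\<close> as \<open>h i \<amalg> h j\<close> followed by the codiagonal of \<open>W\<close>, the Mackey condition for
  the squares on the two summands computes the components of \<open>(h i \<amalg> h j)\<^sub>* z\<close>. This formula is the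
  source of all properties of the multiplication below.
\<close>

lemma push_coproduct:
  assumes X: "X \<in> fin_gsets G" and Y: "Y \<in> fin_gsets G" and W: "W \<in> fin_gsets G"
    and Z: "is_coproduct G X Y Z i j" and h: "h \<in> gmaps G Z W" and z: "z \<in> mobj M Z"
  shows "mpush M Z W h z =
    mackey_mult G M W (mpush M X W (compose (points X) h i) (mpull M X Z i z))
                      (mpush M Y W (compose (points Y) h j) (mpull M Y Z j z))"
proof -
  let ?p = "compose (points X) h i" and ?q = "compose (points Y) h j"
  obtain V a b where choice: "(SOME (V, a, b). is_coproduct G W W V a b) = (V, a, b)"
    by (metis prod_cases3)
  obtain V\<^sub>0 a\<^sub>0 b\<^sub>0 where "is_coproduct G W W V\<^sub>0 a\<^sub>0 b\<^sub>0"
    using coproduct_exists[OF W W] .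
  then have V: "is_coproduct G W W V a b"
    using someI[of "\<lambda>(V, a, b). is_coproduct G W W V a b" "(V\<^sub>0, a\<^sub>0, b\<^sub>0)"] choice by simp
  note ab = coproduct_left[OF V] coproduct_right[OF V]
  note ij = coproduct_left[OF Z] coproduct_right[OF Z]
  note finZV = coproduct_gset[OF Z] coproduct_gset[OF V]
  have p: "?p \<in> gmaps G X W" and q: "?q \<in> gmaps G Y W"
    using gmaps_compose[OF X ij(1) h] gmaps_compose[OF Y ij(2) h] .
  obtain m where m: "m \<in> gmaps G V W" "compose (points W) m a = gid W" "compose (points W) m b = gid W"
    using coproduct_copair[OF W W V gid_gmaps[OF W] gid_gmaps[OF W]] .
  have fold: "(THE m. m \<in> gmaps G V W \<and> compose (points W) m a = gid W
                  \<and> compose (points W) m b = gid W) = m"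
  proof (rule the_equality)
    fix m' assume "m' \<in> gmaps G V W \<and> compose (points W) m' a = gid W
                  \<and> compose (points W) m' b = gid W"
    then have m': "m' \<in> gmaps G V W" "compose (points W) m' a = gid W" "compose (points W) m' b = gid W"
      by simp_all
    show "m' = m"
      by (rule coproduct_map_eqI[OF V m'(1) m(1)])
         (simp_all add: compose_eqD[OF m(2)] compose_eqD[OF m(3)] compose_eqD[OF m'(2)] compose_eqD[OF m'(3)])
  qed (use m in simp)
  obtain k where k: "k \<in> gmaps G Z V" "compose (points X) k i = compose (points X) a ?p"
      "compose (points Y) k j = compose (points Y) b ?q"
    using coproduct_copair[OF X Y Z gmaps_compose[OF X p ab(1)] gmaps_compose[OF Y q ab(2)]] .
  have mk: "compose (points Z) m k = h"
  proof (rule coproduct_map_eqI[OF Z gmaps_compose[OF finZV(1) k(1) m(1)] h])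
    fix x assume x: "x \<in> points X"
    note ix = gmaps_closed[OF ij(1) x]
    show "compose (points Z) m k (i x) = h (i x)"
      using compose_eqD[OF k(2) x] compose_eqD[OF m(2) gmaps_closed[OF p x]] x ix
        gmaps_closed[OF p x] by (simp add: compose_eq gid_apply)
  next
    fix y assume y: "y \<in> points Y"
    note jy = gmaps_closed[OF ij(2) y]
    show "compose (points Z) m k (j y) = h (j y)"
      using compose_eqD[OF k(3) y] compose_eqD[OF m(3) gmaps_closed[OF q y]] y jy
        gmaps_closed[OF q y] by (simp add: compose_eq gid_apply)
  qed
  let ?v = "mpush M Z V k z"
  have v: "?v \<in> mobj M V"
    using push_in[OF finZV k(1) z] .
  have va: "mpull M W V a ?v = mpush M X W ?p (mpull M X Z i z)"
    using mackey[OF coproduct_summand_pullback[OF X W Z V p q k] z] .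
  have vb: "mpull M W V b ?v = mpush M Y W ?q (mpull M Y Z j z)"
    using mackey[OF coproduct_summand_pullback[OF Y W is_coproduct_sym[OF Z] is_coproduct_sym[OF V]
      q p k(1,3,2)] z] .
  have "(THE v. v \<in> mobj M V \<and> mpull M W V a v = mpush M X W ?p (mpull M X Z i z)
           \<and> mpull M W V b v = mpush M Y W ?q (mpull M Y Z j z)) = ?v"
    using v va vb by (intro the_equality) (auto intro: coproduct_element_eqI[OF W W V])
  moreover have "mpush M Z W h z = mpush M V W m ?v"
    using push_comp[OF finZV W k(1) m(1) z] by (simp add: mk)
  ultimately show ?thesis
    by (simp add: mackey_mult_def choice fold)
qed

text \<open>
  In particular the product does not depend on the disjoint union that was chosen to define it.
\<close>

lemma mult_eq_push_fold:
  assumes X: "X \<in> fin_gsets G" and Z: "is_coproduct G X X Z i j" and z: "z \<in> mobj M Z"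
    and h: "h \<in> gmaps G Z X" "compose (points X) h i = gid X" "compose (points X) h j = gid X"
  shows "mackey_mult G M X (mpull M X Z i z) (mpull M X Z j z) = mpush M Z X h z"
  using push_coproduct[OF X X X Z h(1) z] push_id[OF X] h(2,3)
    pull_in[OF X coproduct_gset[OF Z] coproduct_left[OF Z] z]
    pull_in[OF X coproduct_gset[OF Z] coproduct_right[OF Z] z] by simp

lemma fold_exists:
  fixes X :: "('g, 'u) gset"
  assumes X: "X \<in> fin_gsets G"
  obtains Z i j h where "is_coproduct G X X Z i j" "h \<in> gmaps G Z X"
    "compose (points X) h i = gid X" "compose (points X) h j = gid X"
  using coproduct_exists[OF X X] coproduct_copair[OF X X _ gid_gmaps[OF X] gid_gmaps[OF X]] by metis

text \<open>
  Every product is presented as a push-forward, the form in which it can be compared with other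
  restrictions and push-forwards.
\<close>

lemma mult_witness:
  assumes X: "X \<in> fin_gsets G" and xy: "x \<in> mobj M X" "y \<in> mobj M X"
  obtains Z i j h z where "is_coproduct G X X Z i j" "h \<in> gmaps G Z X"
    "compose (points X) h i = gid X" "compose (points X) h j = gid X"
    "z \<in> mobj M Z" "mpull M X Z i z = x" "mpull M X Z j z = y"
    "mackey_mult G M X x y = mpush M Z X h z"
proof -
  obtain Z i j h where Z: "is_coproduct G X X Z i j" and h: "h \<in> gmaps G Z X"
    "compose (points X) h i = gid X" "compose (points X) h j = gid X"
    using fold_exists[OF X] .
  obtain z where z: "z \<in> mobj M Z" "mpull M X Z i z = x" "mpull M X Z j z = y"
    using coproduct_element[OF X X Z xy] .
  show ?thesis
    using that[OF Z h z] mult_eq_push_fold[OF X Z z(1) h] z by simp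
qed

lemma empty_element:
  obtains e where "e \<in> mobj M (gempty G)" "\<And>e'. e' \<in> mobj M (gempty G) \<Longrightarrow> e' = e"
    "\<And>X. mackey_one G M X = mpush M (gempty G) X (\<lambda>x \<in> {}. x) e"
  using empty theI'[OF empty] by (metis mackey_one_def)

lemma mult_closed:
  assumes "X \<in> fin_gsets G" "x \<in> mobj M X" "y \<in> mobj M X"
  shows "mackey_mult G M X x y \<in> mobj M X"
  using mult_witness[OF assms] push_in coproduct_gset assms(1) by metis

lemma mult_comm:
  assumes X: "X \<in> fin_gsets G" and xy: "x \<in> mobj M X" "y \<in> mobj M X"
  shows "mackey_mult G M X x y = mackey_mult G M X y x"
proof -
  obtain Z i j h z where Z: "is_coproduct G X X Z i j" and h: "h \<in> gmaps G Z X"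
      "compose (points X) h i = gid X" "compose (points X) h j = gid X"
    and z: "z \<in> mobj M Z" "mpull M X Z i z = x" "mpull M X Z j z = y"
    and xy: "mackey_mult G M X x y = mpush M Z X h z"
    using mult_witness[OF X xy] .
  show ?thesis
    using mult_eq_push_fold[OF X is_coproduct_sym[OF Z] z(1) h(1,3,2)] z xy by simp
qed

text \<open>
  \<open>X\<close> is itself a disjoint union of \<open>X\<close> and \<open>\<emptyset>\<close>, so \<open>x = id\<^sub>* x\<close> is a product of \<open>x\<close> with a push-forward
  from \<open>\<emptyset>\<close>.
\<close>

lemma mult_one:
  assumes X: "X \<in> fin_gsets G" and x: "x \<in> mobj M X"
  shows "mackey_mult G M X x (mackey_one G M X) = x"
proof -
  obtain e where e: "e \<in> mobj M (gempty G)" "\<And>e'. e' \<in> mobj M (gempty G) \<Longrightarrow> e' = e"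
    "\<And>X. mackey_one G M X = mpush M (gempty G) X (\<lambda>x \<in> {}. x) e"
    using empty_element by metis
  have "mpull M (gempty G) X (\<lambda>x \<in> {}. x) x = e"
    using e(2) pull_in[OF gempty_fin_gset X gempty_gmaps x] .
  then show ?thesis
    using push_coproduct[OF X gempty_fin_gset X is_coproduct_gempty[OF X] gid_gmaps[OF X] x]
    by (simp add: X x push_id pull_id e(3) compose_gempty compose_gid_left[OF gid_gmaps[OF X]])
qed

text \<open>
  Both sides are the push-forward of one element of \<open>M(X \<amalg> X \<amalg> X)\<close> along the threefold codiagonal;
  they arise from \<open>push_coproduct\<close> for the decompositions \<open>(X \<amalg> X) \<amalg> X\<close> and \<open>X \<amalg> (X \<amalg> X)\<close>.
\<close>

lemma mult_assoc:
  assumes X: "X \<in> fin_gsets G" and "x \<in> mobj M X" "y \<in> mobj M X" and w: "w \<in> mobj M X"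
  shows "mackey_mult G M X (mackey_mult G M X x y) w = mackey_mult G M X x (mackey_mult G M X y w)"
proof -
  obtain Z i j h z where Z: "is_coproduct G X X Z i j" and h: "h \<in> gmaps G Z X"
      "compose (points X) h i = gid X" "compose (points X) h j = gid X"
    and z: "z \<in> mobj M Z" "mpull M X Z i z = x" "mpull M X Z j z = y"
    and xy: "mackey_mult G M X x y = mpush M Z X h z"
    using mult_witness[OF assms(1-3)] .
  note finZ = coproduct_gset[OF Z]
  note ij = coproduct_left[OF Z] coproduct_right[OF Z]
  obtain T p q where T: "is_coproduct G Z X T p q"
    using coproduct_exists[OF finZ X] .
  note finT = coproduct_gset[OF T]
  note pq = coproduct_left[OF T] coproduct_right[OF T]
  obtain t where t: "t \<in> mobj M T" "mpull M Z T p t = z" "mpull M X T q t = w"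
    using coproduct_element[OF finZ X T z(1) w] .
  obtain k where k: "k \<in> gmaps G T X" "compose (points Z) k p = h" "compose (points X) k q = gid X"
    using coproduct_copair[OF finZ X T h(1) gid_gmaps[OF X]] .
  have left: "mpush M T X k t = mackey_mult G M X (mackey_mult G M X x y) w"
    using push_coproduct[OF finZ X X T k(1) t(1)] by (simp add: k t xy push_id[OF X w])
  \<comment> \<open>\<open>T\<close> regrouped: its summands are the first copy of \<open>X\<close> and, via \<open>r\<close>, the other two.\<close>
  let ?pi = "compose (points X) p i" and ?pj = "compose (points X) p j"
  have pi: "?pi \<in> gmaps G X T" and pj: "?pj \<in> gmaps G X T"
    using gmaps_compose[OF X ij(1) pq(1)] gmaps_compose[OF X ij(2) pq(1)] .
  obtain r where r: "r \<in> gmaps G Z T" "compose (points X) r i = ?pj" "compose (points X) r j = q"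
    using coproduct_copair[OF X X Z pj pq(2)] .
  have ri: "r (i x) = p (j x)" and rj: "r (j x) = q x" if "x \<in> points X" for x
    using compose_eqD[OF r(2) that] compose_eqD[OF r(3) that] that by (simp_all add: compose_eq)
  have T': "is_coproduct G X Z T ?pi r"
    unfolding is_coproduct_def
  proof (intro conjI)
    have iZ: "i x \<in> points Z" "j x \<in> points Z" if "x \<in> points X" for x
      using gmaps_closed[OF ij(1) that] gmaps_closed[OF ij(2) that] .
    show "inj_on ?pi (points X)"
      using coproduct_inj_left[OF T iZ(1) iZ(1)] coproduct_inj_left[OF Z]
      by (simp add: inj_on_def compose_eq)
    have r_eqD: "(\<exists>x \<in> points X. z = i x \<and> r z = p (j x)) \<or> (\<exists>x \<in> points X. z = j x \<and> r z = q x)"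
      if "z \<in> points Z" for z
      using Z that by (cases rule: coproduct_cases) (use ri rj in blast)+
    show "inj_on r (points Z)"
    proof (rule inj_onI)
      fix z z' assume zz: "z \<in> points Z" "z' \<in> points Z" and eq: "r z = r z'"
      have "p (j x) \<noteq> q x'" if "x \<in> points X" "x' \<in> points X" for x x'
        using coproduct_distinct[OF T iZ(2)] that by blast
      moreover have "p (j x) = p (j x') \<Longrightarrow> x = x'" if "x \<in> points X" "x' \<in> points X" for x x'
        using that coproduct_inj_left[OF T iZ(2) iZ(2)] coproduct_inj_right[OF Z] by blast
      moreover have "q x = q x' \<Longrightarrow> x = x'" if "x \<in> points X" "x' \<in> points X" for x x'
        using that coproduct_inj_right[OF T] by blast
      ultimately show "z = z'"
        using r_eqD[OF zz(1)] r_eqD[OF zz(2)] eq by metis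
    qed
    have "p (i x) \<noteq> r z" if "x \<in> points X" "z \<in> points Z" for x z
      using r_eqD[OF that(2)] that(1) coproduct_distinct[OF T iZ(1)]
        coproduct_inj_left[OF T iZ(1) iZ(2)] coproduct_distinct[OF Z] by metis
    then show "?pi ` points X \<inter> r ` points Z = {}"
      by (auto simp: compose_eq)
    have "c \<in> ?pi ` points X \<union> r ` points Z" if "c \<in> points T" for c
      using T that
    proof (cases rule: coproduct_cases)
      case (1 z)
      from Z 1(1) show ?thesis
      proof (cases rule: coproduct_cases)
        case x: (1 x)
        then show ?thesis
          using 1(2) by (auto simp: image_iff compose_eq)
      next
        case x: (2 x)
        then show ?thesis
          using 1(2) ri[OF x(1)] iZ(1)[OF x(1)] by (metis UnI2 imageI)
      qed
    next
      case (2 x)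
      then show ?thesis
        using rj[OF 2(1)] iZ(2)[OF 2(1)] by (metis UnI2 imageI)
    qed
    then show "?pi ` points X \<union> r ` points Z = points T"
      using gmaps_closed[OF pi] gmaps_closed[OF r(1)] by blast
  qed (fact finT pi r(1))+
  let ?h' = "compose (points Z) k r"
  have h': "?h' \<in> gmaps G Z X"
    using gmaps_compose[OF finZ r(1) k(1)] .
  have kp: "compose (points X) k ?pi = gid X" "compose (points X) k ?pj = gid X"
    using gmaps_compose_assoc[OF ij(1), of k p] gmaps_compose_assoc[OF ij(2), of k p] k(2) h by simp_all
  have h'_ij: "compose (points X) ?h' i = gid X" "compose (points X) ?h' j = gid X"
    using gmaps_compose_assoc[OF ij(1), of k r] gmaps_compose_assoc[OF ij(2), of k r] r kp k by simp_all
  let ?u = "mpull M Z T r t"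
  have u: "?u \<in> mobj M Z"
    using pull_in[OF finZ finT r(1) t(1)] .
  have ui: "mpull M X Z i ?u = y"
    using pull_comp[OF X finZ finT ij(1) r(1) t(1)] pull_comp[OF X finZ finT ij(2) pq(1) t(1)] r(2) t(2) z(3)
    by simp
  have uj: "mpull M X Z j ?u = w"
    using pull_comp[OF X finZ finT ij(2) r(1) t(1)] r(3) t(3) by simp
  have x: "mpull M X T ?pi t = x"
    using pull_comp[OF X finZ finT ij(1) pq(1) t(1)] t(2) z(2) by simp
  have "mpush M Z X ?h' ?u = mackey_mult G M X y w"
    using mult_eq_push_fold[OF X Z u h' h'_ij] ui uj by simp
  then have "mpush M T X k t = mackey_mult G M X x (mackey_mult G M X y w)"
    using push_coproduct[OF X finZ X T' k(1) t(1)] by (simp add: kp x push_id[OF X assms(2)])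
  with left show ?thesis
    by simp
qed

lemma one_closed: "X \<in> fin_gsets G \<Longrightarrow> mackey_one G M X \<in> mobj M X"
  using empty_element push_in[OF gempty_fin_gset _ gempty_gmaps] by metis

lemma mon_comm_monoid:
  assumes "X \<in> fin_gsets G"
  shows "comm_monoid (mon X)"
proof (rule comm_monoidI, unfold mon_simps)
  show "mackey_mult G M X (mackey_one G M X) x = x" if "x \<in> mobj M X" for x
    using mult_comm[OF assms one_closed[OF assms] that] mult_one[OF assms that] by simp
qed (fact mult_closed[OF assms] one_closed[OF assms] mult_assoc[OF assms] mult_comm[OF assms])+

lemma push_mult:
  assumes X: "X \<in> fin_gsets G" and Y: "Y \<in> fin_gsets G" and f: "f \<in> gmaps G X Y"
    and xy: "x \<in> mobj M X" "y \<in> mobj M X"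
  shows "mpush M X Y f (mackey_mult G M X x y) = mackey_mult G M Y (mpush M X Y f x) (mpush M X Y f y)"
proof -
  obtain Z i j h z where Z: "is_coproduct G X X Z i j" and h: "h \<in> gmaps G Z X"
      "compose (points X) h i = gid X" "compose (points X) h j = gid X"
    and z: "z \<in> mobj M Z" "mpull M X Z i z = x" "mpull M X Z j z = y"
    and xy: "mackey_mult G M X x y = mpush M Z X h z"
    using mult_witness[OF X xy] .
  note finZ = coproduct_gset[OF Z]
  have "mpush M X Y f (mpush M Z X h z) = mpush M Z Y (compose (points Z) f h) z"
    using push_comp[OF finZ X Y h(1) f z(1)] by simp
  also have "\<dots> = mackey_mult G M Y (mpush M X Y f x) (mpush M X Y f y)"
    using push_coproduct[OF X X Y Z gmaps_compose[OF finZ h(1) f] z(1)] z h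
    by (simp add: gmaps_compose_assoc[OF coproduct_left[OF Z]]
        gmaps_compose_assoc[OF coproduct_right[OF Z]] compose_gid_right[OF f])
  finally show ?thesis
    using xy by simp
qed

text \<open>
  Restriction along \<open>f \<amalg> f\<close> sends the element with components \<open>y, y'\<close> to the one with components
  \<open>f\<^sup>* y, f\<^sup>* y'\<close>, and the Mackey condition for the naturality square of the codiagonal exchanges
  restriction and push-forward.
\<close>

lemma pull_mult:
  assumes X: "X \<in> fin_gsets G" and Y: "Y \<in> fin_gsets G" and f: "f \<in> gmaps G X Y"
    and yy: "y \<in> mobj M Y" "y' \<in> mobj M Y"
  shows "mpull M X Y f (mackey_mult G M Y y y') = mackey_mult G M X (mpull M X Y f y) (mpull M X Y f y')"
proof -
  obtain V a b m v where V: "is_coproduct G Y Y V a b" and m: "m \<in> gmaps G V Y"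
      "compose (points Y) m a = gid Y" "compose (points Y) m b = gid Y"
    and v: "v \<in> mobj M V" "mpull M Y V a v = y" "mpull M Y V b v = y'"
    and yy: "mackey_mult G M Y y y' = mpush M V Y m v"
    using mult_witness[OF Y yy] .
  obtain Z i j h where Z: "is_coproduct G X X Z i j" and h: "h \<in> gmaps G Z X"
    "compose (points X) h i = gid X" "compose (points X) h j = gid X"
    using fold_exists[OF X] .
  note ab = coproduct_left[OF V] coproduct_right[OF V]
  note ij = coproduct_left[OF Z] coproduct_right[OF Z]
  note finZV = coproduct_gset[OF Z] coproduct_gset[OF V]
  obtain k where k: "k \<in> gmaps G Z V" "compose (points X) k i = compose (points X) a f"
      "compose (points X) k j = compose (points X) b f"
    using coproduct_copair[OF X X Z gmaps_compose[OF X f ab(1)] gmaps_compose[OF X f ab(2)]] .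
  let ?z = "mpull M Z V k v"
  have z: "?z \<in> mobj M Z"
    using pull_in[OF finZV k(1) v(1)] .
  have "mpull M X Z i ?z = mpull M X Y f y" "mpull M X Z j ?z = mpull M X Y f y'"
    using pull_comp[OF X finZV ij(1) k(1) v(1)] pull_comp[OF X Y finZV(2) f ab(1) v(1)]
      pull_comp[OF X finZV ij(2) k(1) v(1)] pull_comp[OF X Y finZV(2) f ab(2) v(1)] k v by simp_all
  moreover have "mpull M X Y f (mpush M V Y m v) = mpush M Z X h ?z"
    using mackey[OF codiagonal_pullback[OF X Y Z V f k h m] v(1)] .
  ultimately show ?thesis
    using mult_eq_push_fold[OF X Z z h] yy by simp
qed

lemma push_one:
  assumes "X \<in> fin_gsets G" "Y \<in> fin_gsets G" "f \<in> gmaps G X Y"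
  shows "mpush M X Y f (mackey_one G M X) = mackey_one G M Y"
proof -
  obtain e where e: "e \<in> mobj M (gempty G)"
    "\<And>X. mackey_one G M X = mpush M (gempty G) X (\<lambda>x \<in> {}. x) e"
    using empty_element by metis
  show ?thesis
    using push_comp[OF gempty_fin_gset assms(1,2) gempty_gmaps assms(3) e(1)]
    by (simp add: e(2) compose_gempty)
qed

lemma pull_one:
  assumes "X \<in> fin_gsets G" "Y \<in> fin_gsets G" "f \<in> gmaps G X Y"
  shows "mpull M X Y f (mackey_one G M Y) = mackey_one G M X"
proof -
  obtain e where e: "e \<in> mobj M (gempty G)"
    "\<And>X. mackey_one G M X = mpush M (gempty G) X (\<lambda>x \<in> {}. x) e"
    using empty_element by metis
  show ?thesis
    using mackey[OF gempty_pullback[OF assms] e(1)] by (simp add: e pull_id[OF gempty_fin_gset])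
qed

lemma push_hom:
  "\<lbrakk>X \<in> fin_gsets G; Y \<in> fin_gsets G; f \<in> gmaps G X Y\<rbrakk> \<Longrightarrow> mpush M X Y f \<in> hom (mon X) (mon Y)"
  by (auto simp: hom_def mon_simps push_in push_mult)

lemma pull_hom:
  "\<lbrakk>X \<in> fin_gsets G; Y \<in> fin_gsets G; f \<in> gmaps G X Y\<rbrakk> \<Longrightarrow> mpull M X Y f \<in> hom (mon Y) (mon X)"
  by (auto simp: hom_def mon_simps pull_in pull_mult)

end

section \<open>Fractions of commutative monoids\<close>

locale monoid_fractions = comm_monoid A + submonoid S A
  for A :: "('a, 'c) monoid_scheme" (structure) and S :: "'a set"
begin

abbreviation F :: "('a \<times> 'a) set monoid" where
  "F \<equiv> frac_monoid A S"

lemma denominator_carrier: "s \<in> S \<Longrightarrow> s \<in> carrier A"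
  using subset by blast

lemma frac_rel_iff:
  "((x, s), (y, t)) \<in> frac_rel A S \<longleftrightarrow> x \<in> carrier A \<and> s \<in> S \<and> y \<in> carrier A \<and> t \<in> S
     \<and> (\<exists>u \<in> S. u \<otimes> (t \<otimes> x) = u \<otimes> (s \<otimes> y))"
  by (simp add: frac_rel_def)

lemma frac_rel_equiv: "equiv (carrier A \<times> S) (frac_rel A S)"
proof (rule equivI)
  show "frac_rel A S \<subseteq> (carrier A \<times> S) \<times> (carrier A \<times> S)"
    by (auto simp: frac_rel_def)
  show "refl_on (carrier A \<times> S) (frac_rel A S)"
    by (auto simp: refl_on_def frac_rel_iff)
  show "sym (frac_rel A S)"
    by (auto simp: sym_def frac_rel_iff) metis
  show "trans (frac_rel A S)"
    unfolding trans_def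
  proof clarify
    fix x s y t z r
    assume xy: "((x, s), (y, t)) \<in> frac_rel A S" and yz: "((y, t), (z, r)) \<in> frac_rel A S"
    obtain u v where u: "u \<in> S" "u \<otimes> (t \<otimes> x) = u \<otimes> (s \<otimes> y)"
      and v: "v \<in> S" "v \<otimes> (r \<otimes> y) = v \<otimes> (t \<otimes> z)"
      using xy yz by (auto simp: frac_rel_iff)
    have carr: "x \<in> carrier A" "y \<in> carrier A" "z \<in> carrier A" "s \<in> S" "t \<in> S" "r \<in> S"
      using xy yz by (auto simp: frac_rel_iff)
    note cl = carr u(1) v(1) denominator_carrier
    have "(u \<otimes> v \<otimes> t) \<otimes> (r \<otimes> x) = (v \<otimes> r) \<otimes> (u \<otimes> (t \<otimes> x))"
      using cl by (simp add: m_ac)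
    also have "\<dots> = (u \<otimes> s) \<otimes> (v \<otimes> (r \<otimes> y))"
      unfolding u(2) using cl by (simp add: m_ac)
    also have "\<dots> = (u \<otimes> v \<otimes> t) \<otimes> (s \<otimes> z)"
      unfolding v(2) using cl by (simp add: m_ac)
    finally show "((x, s), (z, r)) \<in> frac_rel A S"
      using cl unfolding frac_rel_iff by (intro conjI bexI[of _ "u \<otimes> v \<otimes> t"]) auto
  qed
qed

lemma frac_eq_iff:
  assumes "x \<in> carrier A" "s \<in> S" "y \<in> carrier A" "t \<in> S"
  shows "frac A S x s = frac A S y t \<longleftrightarrow> (\<exists>u \<in> S. u \<otimes> (t \<otimes> x) = u \<otimes> (s \<otimes> y))"
  unfolding frac_def using assms by (subst eq_equiv_class_iff[OF frac_rel_equiv]) (auto simp: frac_rel_iff)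

lemma frac_in: "\<lbrakk>x \<in> carrier A; s \<in> S\<rbrakk> \<Longrightarrow> frac A S x s \<in> carrier F"
  by (simp add: frac_monoid_def frac_def quotientI)

lemma frac_cases:
  assumes "c \<in> carrier F"
  obtains x s where "x \<in> carrier A" "s \<in> S" "c = frac A S x s"
  using assms by (auto simp: frac_monoid_def frac_def elim!: quotientE)

lemma frac_cancel:
  assumes "x \<in> carrier A" "s \<in> S" "u \<in> S"
  shows "frac A S (u \<otimes> x) (u \<otimes> s) = frac A S x s"
  using assms denominator_carrier by (subst frac_eq_iff) (auto intro!: bexI[of _ u] simp: m_ac)

text \<open>
  Operations on fractions are unions over representatives; such a union is evaluated at a single
  representative as soon as the value only depends on the fraction.
\<close>

lemma UN_frac:
  assumes "\<And>x s y t. \<lbrakk>x \<in> carrier A; s \<in> S; y \<in> carrier A; t \<in> S; frac A S x s = frac A S y t\<rbrakk> \<Longrightarrow> f x s = f y t"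
    and "x \<in> carrier A" "s \<in> S"
  shows "(\<Union>(y, t) \<in> frac A S x s. f y t) = f x s"
proof -
  have "congruent (frac_rel A S) (\<lambda>(y, t). f y t)"
  proof (rule congruentI)
    fix p q assume "(p, q) \<in> frac_rel A S"
    moreover obtain y t z r where "p = (y, t)" "q = (z, r)"
      by (cases p, cases q)
    ultimately show "(\<lambda>(y, t). f y t) p = (\<lambda>(y, t). f y t) q"
      using assms(1)[of y t z r] by (simp add: frac_rel_iff frac_eq_iff)
  qed
  from UN_equiv_class[OF frac_rel_equiv this, of "(x, s)"] show ?thesis
    using assms(2,3) by (simp add: frac_def)
qed

lemma frac_mult_cong:
  assumes "x \<in> carrier A" "s \<in> S" "x' \<in> carrier A" "s' \<in> S" "frac A S x s = frac A S x' s'"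
    and "y \<in> carrier A" "t \<in> S"
  shows "frac A S (x \<otimes> y) (s \<otimes> t) = frac A S (x' \<otimes> y) (s' \<otimes> t)"
proof -
  obtain u where u: "u \<in> S" "u \<otimes> (s' \<otimes> x) = u \<otimes> (s \<otimes> x')"
    using assms frac_eq_iff by auto
  note cl = assms u(1) denominator_carrier
  have "u \<otimes> ((s' \<otimes> t) \<otimes> (x \<otimes> y)) = (t \<otimes> y) \<otimes> (u \<otimes> (s' \<otimes> x))"
    using cl by (simp add: m_ac)
  also have "\<dots> = u \<otimes> ((s \<otimes> t) \<otimes> (x' \<otimes> y))"
    unfolding u(2) using cl by (simp add: m_ac)
  finally show ?thesis
    using cl by (subst frac_eq_iff) auto
qed

lemma frac_mult:
  assumes "x \<in> carrier A" "s \<in> S" "y \<in> carrier A" "t \<in> S"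
  shows "frac A S x s \<otimes>\<^bsub>F\<^esub> frac A S y t = frac A S (x \<otimes> y) (s \<otimes> t)"
proof -
  have inner: "(\<Union>(y, t) \<in> frac A S y t. frac A S (x' \<otimes> y) (s' \<otimes> t)) = frac A S (x' \<otimes> y) (s' \<otimes> t)"
    if "x' \<in> carrier A" "s' \<in> S" for x' s'
  proof (rule UN_frac[OF _ assms(3,4)])
    fix y t z r
    assume yz: "y \<in> carrier A" "t \<in> S" "z \<in> carrier A" "r \<in> S" "frac A S y t = frac A S z r"
    show "frac A S (x' \<otimes> y) (s' \<otimes> t) = frac A S (x' \<otimes> z) (s' \<otimes> r)"
      using frac_mult_cong[OF yz that] that yz(1-4)
      by (simp add: m_comm[of x'] m_comm[of s'] denominator_carrier)
  qed
  have rep: "x' \<in> carrier A \<and> s' \<in> S" if "(x', s') \<in> frac A S x s" for x' s'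
    using that by (simp add: frac_def frac_rel_iff)
  have "frac A S x s \<otimes>\<^bsub>F\<^esub> frac A S y t = (\<Union>(x', s') \<in> frac A S x s. frac A S (x' \<otimes> y) (s' \<otimes> t))"
    unfolding frac_monoid_def monoid.simps
  proof (rule SUP_cong[OF refl])
    fix p assume "p \<in> frac A S x s"
    then show "(case p of (x', s') \<Rightarrow> \<Union>(y, t) \<in> frac A S y t. frac A S (x' \<otimes> y) (s' \<otimes> t))
        = (case p of (x', s') \<Rightarrow> frac A S (x' \<otimes> y) (s' \<otimes> t))"
      using rep[of "fst p" "snd p"] inner[of "fst p" "snd p"] by (cases p) simp
  qed
  also have "\<dots> = frac A S (x \<otimes> y) (s \<otimes> t)"
    by (rule UN_frac[OF _ assms(1,2)]) (rule frac_mult_cong[OF _ _ _ _ _ assms(3,4)])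
  finally show ?thesis .
qed

lemma frac_one: "\<one>\<^bsub>F\<^esub> = frac A S \<one> \<one>"
  by (simp add: frac_monoid_def)

lemma frac_comm_monoid: "comm_monoid F"
proof (rule comm_monoidI)
  fix a b c assume a: "a \<in> carrier F" and b: "b \<in> carrier F" and c: "c \<in> carrier F"
  obtain x s where x: "x \<in> carrier A" "s \<in> S" "a = frac A S x s" using frac_cases[OF a] .
  obtain y t where y: "y \<in> carrier A" "t \<in> S" "b = frac A S y t" using frac_cases[OF b] .
  obtain z r where z: "z \<in> carrier A" "r \<in> S" "c = frac A S z r" using frac_cases[OF c] .
  show "a \<otimes>\<^bsub>F\<^esub> b \<in> carrier F"
    using x y by (simp add: frac_mult frac_in)
  show "a \<otimes>\<^bsub>F\<^esub> b \<otimes>\<^bsub>F\<^esub> c = a \<otimes>\<^bsub>F\<^esub> (b \<otimes>\<^bsub>F\<^esub> c)"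
    using x y z by (simp add: frac_mult m_assoc denominator_carrier)
  show "a \<otimes>\<^bsub>F\<^esub> b = b \<otimes>\<^bsub>F\<^esub> a"
    using x y by (simp add: frac_mult m_comm denominator_carrier)
  show "\<one>\<^bsub>F\<^esub> \<otimes>\<^bsub>F\<^esub> a = a"
    using x by (simp add: frac_one frac_mult denominator_carrier)
qed (simp add: frac_one frac_in)

lemma frac_map:
  assumes B: "monoid_fractions B T" and h: "h \<in> hom A B" "h ` S \<subseteq> T"
    and xs: "x \<in> carrier A" "s \<in> S"
  shows "(\<Union>(y, t) \<in> frac A S x s. frac B T (h y) (h t)) = frac B T (h x) (h s)"
proof (rule UN_frac[OF _ xs])
  fix x s y t
  assume xy: "x \<in> carrier A" "s \<in> S" "y \<in> carrier A" "t \<in> S" "frac A S x s = frac A S y t"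
  then obtain u where u: "u \<in> S" "u \<otimes> (t \<otimes> x) = u \<otimes> (s \<otimes> y)"
    using frac_eq_iff by auto
  have "h u \<otimes>\<^bsub>B\<^esub> (h t \<otimes>\<^bsub>B\<^esub> h x) = h u \<otimes>\<^bsub>B\<^esub> (h s \<otimes>\<^bsub>B\<^esub> h y)"
    using arg_cong[OF u(2), of h] xy u(1) denominator_carrier by (simp add: hom_mult[OF h(1)])
  then show "frac B T (h x) (h s) = frac B T (h y) (h t)"
    using xy u(1) h hom_in_carrier[OF h(1)]
    by (subst monoid_fractions.frac_eq_iff[OF B]) auto
qed

lemma frac_numerator_hom: "(\<lambda>x. frac A S x \<one>) \<in> hom A F"
  by (auto simp: hom_def frac_in frac_mult)

lemma frac_denominator_Units:
  assumes "s \<in> S"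
  shows "frac A S s \<one> \<in> Units F"
proof -
  have "frac A S s s = \<one>\<^bsub>F\<^esub>"
    using frac_cancel[of \<one> \<one> s] assms denominator_carrier by (simp add: frac_one)
  moreover note s = denominator_carrier[OF assms]
  ultimately have "frac A S \<one> s \<otimes>\<^bsub>F\<^esub> frac A S s \<one> = \<one>\<^bsub>F\<^esub>" "frac A S s \<one> \<otimes>\<^bsub>F\<^esub> frac A S \<one> s = \<one>\<^bsub>F\<^esub>"
    using assms by (simp_all add: frac_mult)
  then show ?thesis
    using frac_in[OF s one_closed] frac_in[OF denominator_carrier[OF one_closed] assms] unfolding Units_def by blast
qed

lemma frac_mult_denominator:
  assumes "x \<in> carrier A" "s \<in> S"
  shows "frac A S x s \<otimes>\<^bsub>F\<^esub> frac A S s \<one> = frac A S x \<one>"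
  using frac_cancel[of x \<one> s] assms denominator_carrier by (simp add: frac_mult m_comm)

end

lemma (in comm_monoid) Units_eq_divide:
  assumes "u \<in> Units G" "d \<in> carrier G" "b \<in> carrier G"
  shows "d = b \<otimes> inv u \<longleftrightarrow> d \<otimes> u = b"
  using assms by (auto simp: m_assoc Units_closed)

lemma (in comm_monoid) Units_cancel:
  assumes "u \<in> Units G" "d \<in> carrier G" "d' \<in> carrier G" "d \<otimes> u = d' \<otimes> u"
  shows "d = d'"
  using assms Units_eq_divide by (metis Units_closed m_closed)

lemma hom_Units:
  assumes "h \<in> hom A B" "h \<one>\<^bsub>A\<^esub> = \<one>\<^bsub>B\<^esub>" "u \<in> Units A"
  shows "h u \<in> Units B"
proof -
  obtain v where v: "v \<in> carrier A" "u \<in> carrier A" "v \<otimes>\<^bsub>A\<^esub> u = \<one>\<^bsub>A\<^esub>" "u \<otimes>\<^bsub>A\<^esub> v = \<one>\<^bsub>A\<^esub>"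
    using assms(3) by (auto simp: Units_def)
  then show ?thesis
    using assms(2) hom_mult[OF assms(1), of u v] hom_mult[OF assms(1), of v u] hom_in_carrier[OF assms(1)]
    by (auto simp: Units_def intro!: bexI[of _ "h v"])
qed

context monoid_fractions
begin

text \<open>
  The equation \<open>\<psi>(x / s) \<psi>(s / 1) = \<psi>(x / 1)\<close> can be solved for \<open>\<psi>(x / s)\<close>, as \<open>\<psi>(s / 1)\<close>
  is invertible.
\<close>

lemma frac_hom_unique:
  assumes C: "comm_monoid C" and "\<psi> \<in> hom F C" "\<psi>' \<in> hom F C"
    and units: "\<And>s. s \<in> S \<Longrightarrow> \<psi> (frac A S s \<one>) \<in> Units C"
    and eq: "\<And>x. x \<in> carrier A \<Longrightarrow> \<psi> (frac A S x \<one>) = \<psi>' (frac A S x \<one>)"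
    and c: "c \<in> carrier F"
  shows "\<psi> c = \<psi>' c"
proof -
  obtain x s where x: "x \<in> carrier A" "s \<in> S" "c = frac A S x s"
    using frac_cases[OF c] .
  note s1 = frac_in[OF denominator_carrier[OF x(2)] one_closed]
  have "\<chi> c \<otimes>\<^bsub>C\<^esub> \<chi> (frac A S s \<one>) = \<chi> (frac A S x \<one>)" if "\<chi> \<in> hom F C" for \<chi>
    using hom_mult[OF that c s1] frac_mult_denominator[OF x(1,2)] x(3) by simp
  from this[OF assms(2)] this[OF assms(3)]
  show ?thesis
    using comm_monoid.Units_cancel[OF C units[OF x(2)]] hom_in_carrier[OF assms(2) c]
      hom_in_carrier[OF assms(3) c] eq[OF x(1)] eq[OF denominator_carrier[OF x(2)]] by simp
qed

text \<open>
  The value at \<open>x / s\<close> has to be a solution \<open>d\<close> of \<open>d \<phi>(s) = \<phi>(x)\<close>, which is unique because \<open>\<phi>(s)\<close> is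
  invertible. Well-definedness and multiplicativity follow by checking this equation.
\<close>

lemma frac_hom_exists:
  fixes C :: "('d, 'e) monoid_scheme"
  assumes C: "comm_monoid C" and \<phi>: "\<phi> \<in> hom A C" "\<phi> \<one> = \<one>\<^bsub>C\<^esub>" "\<phi> ` S \<subseteq> Units C"
  obtains \<psi> where "\<psi> \<in> monoid_homs F C" "\<And>x. x \<in> carrier A \<Longrightarrow> \<psi> (frac A S x \<one>) = \<phi> x"
proof -
  interpret C: comm_monoid C by (rule C)
  define q where "q x s = \<phi> x \<otimes>\<^bsub>C\<^esub> inv\<^bsub>C\<^esub> \<phi> s" for x s
  define \<psi> where "\<psi> = (\<lambda>c \<in> carrier F. the_elem ((\<lambda>(x, s). q x s) ` c))"
  have unit: "\<phi> s \<in> Units C" if "s \<in> S" for s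
    using \<phi>(3) that by blast
  have phi_in: "\<phi> x \<in> carrier C" if "x \<in> carrier A" for x
    using hom_in_carrier[OF \<phi>(1) that] .
  have q_in: "q x s \<in> carrier C" if "x \<in> carrier A" "s \<in> S" for x s
    using that phi_in unit by (simp add: q_def)
  have q_eqI: "d = q x s" if "x \<in> carrier A" "s \<in> S" "d \<in> carrier C" "d \<otimes>\<^bsub>C\<^esub> \<phi> s = \<phi> x" for d x s
    using C.Units_eq_divide[OF unit[OF that(2)] that(3) phi_in[OF that(1)]] that(4) by (simp add: q_def)
  have q_mult: "q x s \<otimes>\<^bsub>C\<^esub> \<phi> s = \<phi> x" if "x \<in> carrier A" "s \<in> S" for x s
    using C.Units_eq_divide[OF unit[OF that(2)] q_in[OF that] phi_in[OF that(1)]] by (simp add: q_def)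
  have q_cong: "q x s = q y t"
    if xy: "x \<in> carrier A" "s \<in> S" "y \<in> carrier A" "t \<in> S" "frac A S x s = frac A S y t" for x s y t
  proof (rule q_eqI[OF xy(3,4) q_in[OF xy(1,2)]])
    let ?d = "q x s"
    obtain u where u: "u \<in> S" "u \<otimes> (t \<otimes> x) = u \<otimes> (s \<otimes> y)"
      using frac_eq_iff xy by auto
    note cl = xy(1-4) u(1) denominator_carrier phi_in q_in[OF xy(1,2)]
    \<comment> \<open>The factor \<open>u\<close> that witnesses the equality of fractions is sent to a unit and cancels.\<close>
    have "\<phi> u \<otimes>\<^bsub>C\<^esub> (\<phi> t \<otimes>\<^bsub>C\<^esub> \<phi> x) = \<phi> u \<otimes>\<^bsub>C\<^esub> (\<phi> s \<otimes>\<^bsub>C\<^esub> \<phi> y)"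
      using arg_cong[OF u(2), of \<phi>] cl by (simp add: hom_mult[OF \<phi>(1)])
    moreover have "(?d \<otimes>\<^bsub>C\<^esub> \<phi> t) \<otimes>\<^bsub>C\<^esub> (\<phi> u \<otimes>\<^bsub>C\<^esub> \<phi> s) = \<phi> u \<otimes>\<^bsub>C\<^esub> (\<phi> t \<otimes>\<^bsub>C\<^esub> (?d \<otimes>\<^bsub>C\<^esub> \<phi> s))"
      using cl by (simp add: C.m_ac)
    ultimately have "(?d \<otimes>\<^bsub>C\<^esub> \<phi> t) \<otimes>\<^bsub>C\<^esub> (\<phi> u \<otimes>\<^bsub>C\<^esub> \<phi> s) = \<phi> y \<otimes>\<^bsub>C\<^esub> (\<phi> u \<otimes>\<^bsub>C\<^esub> \<phi> s)"
      using q_mult[OF xy(1,2)] cl by (simp add: C.m_ac)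
    then show "?d \<otimes>\<^bsub>C\<^esub> \<phi> t = \<phi> y"
      by (rule C.Units_cancel[OF C.Units_m_closed[OF unit[OF u(1)] unit[OF xy(2)]], rotated 2])
         (use cl in simp_all)
  qed
  have psi: "\<psi> (frac A S x s) = q x s" if xs: "x \<in> carrier A" "s \<in> S" for x s
  proof -
    have rep: "y \<in> carrier A \<and> t \<in> S \<and> frac A S y t = frac A S x s" if "(y, t) \<in> frac A S x s" for y t
      using that xs by (auto simp: frac_def frac_rel_iff intro!: equiv_class_eq[OF frac_rel_equiv, symmetric])
    have "(x, s) \<in> frac A S x s"
      using xs by (auto simp: frac_def frac_rel_iff)
    moreover have "(\<lambda>(x, s). q x s) p = q x s" if "p \<in> frac A S x s" for p
      using that rep[of "fst p" "snd p"] q_cong[of "fst p" "snd p" x s] xs by (cases p) simp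
    ultimately have "the_elem ((\<lambda>(x, s). q x s) ` frac A S x s) = (\<lambda>(x, s). q x s) (x, s)"
      by (intro the_elem_image_unique) auto
    then show ?thesis
      using frac_in[OF xs] by (simp add: \<psi>_def)
  qed
  have psi_mult: "\<psi> (frac A S x s) \<otimes>\<^bsub>C\<^esub> \<phi> s = \<phi> x" if "x \<in> carrier A" "s \<in> S" for x s
    using q_mult[OF that] by (simp only: psi[OF that])
  have psi_in: "\<psi> (frac A S x s) \<in> carrier C" if "x \<in> carrier A" "s \<in> S" for x s
    using q_in[OF that] by (simp only: psi[OF that])
  have psi_eqI: "\<psi> (frac A S x s) = d" if "x \<in> carrier A" "s \<in> S" "d \<in> carrier C" "d \<otimes>\<^bsub>C\<^esub> \<phi> s = \<phi> x" for x s d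
    using q_eqI[OF that] by (simp only: psi[OF that(1,2)])
  have num: "\<psi> (frac A S x \<one>) = \<phi> x" if "x \<in> carrier A" for x
    using psi_eqI[of x \<one> "\<phi> x"] that phi_in \<phi>(2) by simp
  have "\<psi> (a \<otimes>\<^bsub>F\<^esub> b) = \<psi> a \<otimes>\<^bsub>C\<^esub> \<psi> b" if ab: "a \<in> carrier F" "b \<in> carrier F" for a b
  proof -
    obtain x s where x: "x \<in> carrier A" "s \<in> S" "a = frac A S x s" using frac_cases[OF ab(1)] .
    obtain y t where y: "y \<in> carrier A" "t \<in> S" "b = frac A S y t" using frac_cases[OF ab(2)] .
    note cl = x(1,2) y(1,2) denominator_carrier phi_in psi_in
    have "\<psi> a \<otimes>\<^bsub>C\<^esub> \<psi> b \<otimes>\<^bsub>C\<^esub> \<phi> (s \<otimes> t) = (\<psi> a \<otimes>\<^bsub>C\<^esub> \<phi> s) \<otimes>\<^bsub>C\<^esub> (\<psi> b \<otimes>\<^bsub>C\<^esub> \<phi> t)"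
      using cl x(3) y(3) by (simp add: hom_mult[OF \<phi>(1)] C.m_ac)
    also have "\<dots> = \<phi> (x \<otimes> y)"
      using cl x(3) y(3) by (simp add: psi_mult hom_mult[OF \<phi>(1)])
    finally have "\<psi> (frac A S (x \<otimes> y) (s \<otimes> t)) = \<psi> a \<otimes>\<^bsub>C\<^esub> \<psi> b"
      using cl x(3) y(3) by (intro psi_eqI) auto
    then show ?thesis
      using x y by (simp add: frac_mult)
  qed
  moreover have "\<psi> c \<in> carrier C" if "c \<in> carrier F" for c
    using frac_cases[OF that] psi_in by metis
  moreover have "\<psi> \<one>\<^bsub>F\<^esub> = \<one>\<^bsub>C\<^esub>"
    using num[OF denominator_carrier[OF one_closed]] \<phi>(2) by (simp add: frac_one)
  ultimately have "\<psi> \<in> monoid_homs F C"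
    by (auto simp: monoid_homs_def hom_def \<psi>_def)
  then show ?thesis
    using that num by blast
qed

end

section \<open>Morphisms of semi-Mackey functors\<close>

lemma smackD:
  assumes "\<theta> \<in> smack G M N" "X \<in> fin_gsets G"
  shows smack_hom: "\<theta> X \<in> hom (mackey_monoid G M X) (mackey_monoid G N X)"
    and smack_one: "\<theta> X (mackey_one G M X) = mackey_one G N X"
    and smack_closed: "x \<in> mobj M X \<Longrightarrow> \<theta> X x \<in> mobj N X"
    and smack_extensional: "\<theta> X \<in> extensional (mobj M X)"
    and smack_pull: "\<lbrakk>Y \<in> fin_gsets G; f \<in> gmaps G X Y; y \<in> mobj M Y\<rbrakk>
      \<Longrightarrow> \<theta> X (mpull M X Y f y) = mpull N X Y f (\<theta> Y y)"
    and smack_push: "\<lbrakk>Y \<in> fin_gsets G; f \<in> gmaps G X Y; x \<in> mobj M X\<rbrakk>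
      \<Longrightarrow> \<theta> Y (mpush M X Y f x) = mpush N X Y f (\<theta> X x)"
proof -
  have "\<theta> X \<in> monoid_homs (mackey_monoid G M X) (mackey_monoid G N X)"
    using assms by (auto simp: smack_def)
  then show "\<theta> X \<in> hom (mackey_monoid G M X) (mackey_monoid G N X)"
    "\<theta> X (mackey_one G M X) = mackey_one G N X" "x \<in> mobj M X \<Longrightarrow> \<theta> X x \<in> mobj N X"
    "\<theta> X \<in> extensional (mobj M X)"
    by (auto simp: monoid_homs_def mackey_monoid_def hom_def)
qed (use assms in \<open>auto simp: smack_def\<close>)

lemma smack_eqI:
  assumes \<theta>: "\<theta> \<in> smack G M N" and \<theta>': "\<theta>' \<in> smack G M N"
    and eq: "\<And>X x. \<lbrakk>X \<in> fin_gsets G; x \<in> mobj M X\<rbrakk> \<Longrightarrow> \<theta> X x = \<theta>' X x"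
  shows "\<theta> = \<theta>'"
proof (rule extensionalityI[of _ "fin_gsets G"])
  show "\<theta> \<in> extensional (fin_gsets G)" "\<theta>' \<in> extensional (fin_gsets G)"
    using \<theta> \<theta>' by (simp_all add: smack_def PiE_def)
  show "\<theta> X = \<theta>' X" if "X \<in> fin_gsets G" for X
    by (rule extensionalityI[OF smack_extensional[OF \<theta> that] smack_extensional[OF \<theta>' that] eq[OF that]])
qed

lemma smack_comp_apply:
  "\<lbrakk>X \<in> fin_gsets G; x \<in> mobj M X\<rbrakk> \<Longrightarrow> smack_comp G M \<psi> \<phi> X x = \<psi> X (\<phi> X x)"
  by (simp add: smack_comp_def compose_eq)

lemma (in group_semi_mackey) smack_compose:
  assumes \<phi>: "\<phi> \<in> smack G M N" and \<psi>: "\<psi> \<in> smack G N K"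
  shows "smack_comp G M \<psi> \<phi> \<in> smack G M K"
proof -
  have "smack_comp G M \<psi> \<phi> X \<in> monoid_homs (mon X) (mackey_monoid G K X)" if X: "X \<in> fin_gsets G" for X
  proof -
    have "compose (mobj M X) (\<psi> X) (\<phi> X) \<in> hom (mon X) (mackey_monoid G K X)"
      using Group.hom_compose[OF smack_hom[OF \<phi> X] smack_hom[OF \<psi> X]] mult_closed[OF X]
      by (simp add: hom_def mon_simps compose_eq Pi_iff)
    then show ?thesis
      using X one_closed[OF X] smack_one[OF \<phi> X] smack_one[OF \<psi> X]
      by (simp add: monoid_homs_def smack_comp_def mackey_monoid_def compose_eq)
  qed
  moreover have "smack_comp G M \<psi> \<phi> \<in> extensional (fin_gsets G)"
    by (simp add: smack_comp_def)
  moreover have "smack_comp G M \<psi> \<phi> X (mpull M X Y f y) = mpull K X Y f (smack_comp G M \<psi> \<phi> Y y)"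
    if "X \<in> fin_gsets G" "Y \<in> fin_gsets G" "f \<in> gmaps G X Y" "y \<in> mobj M Y" for X Y f y
    using that by (simp add: smack_comp_apply pull_in smack_pull[OF \<phi>] smack_pull[OF \<psi>] smack_closed[OF \<phi>])
  moreover have "smack_comp G M \<psi> \<phi> Y (mpush M X Y f x) = mpush K X Y f (smack_comp G M \<psi> \<phi> X x)"
    if "X \<in> fin_gsets G" "Y \<in> fin_gsets G" "f \<in> gmaps G X Y" "x \<in> mobj M X" for X Y f x
    using that by (simp add: smack_comp_apply push_in smack_push[OF \<phi>] smack_push[OF \<psi>] smack_closed[OF \<phi>])
  ultimately show ?thesis
    by (simp add: smack_def PiE_def Pi_def)
qed

section \<open>Fractions of a semi-Mackey functor\<close>

locale mackey_fractions = group_semi_mackey G M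
  for G :: "('g, 'b) monoid_scheme" (structure) and M :: "('g, 'u::infinite, 'm) mackey_data" +
  fixes S :: "('g, 'u) gset \<Rightarrow> 'm set"
  assumes subfunctor: "semi_mackey_subfunctor G S M"
begin

abbreviation L :: "('g, 'u, ('m \<times> 'm) set) mackey_data" where
  "L \<equiv> mackey_loc G M S"

abbreviation fr :: "('g, 'u) gset \<Rightarrow> 'm \<Rightarrow> 'm \<Rightarrow> ('m \<times> 'm) set" where
  "fr \<equiv> mackey_frac G M S"

abbreviation fmon :: "('g, 'u) gset \<Rightarrow> ('m \<times> 'm) set monoid" where
  "fmon X \<equiv> frac_monoid (mon X) (S X)"

lemma fractions: "X \<in> fin_gsets G \<Longrightarrow> monoid_fractions (mon X) (S X)"
  using mon_comm_monoid subfunctor by (simp add: monoid_fractions_def semi_mackey_subfunctor_def)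

lemma denominator:
  assumes "X \<in> fin_gsets G"
  shows denominator_in: "s \<in> S X \<Longrightarrow> s \<in> mobj M X"
    and denominator_one: "mackey_one G M X \<in> S X"
    and denominator_mult: "\<lbrakk>s \<in> S X; t \<in> S X\<rbrakk> \<Longrightarrow> mackey_mult G M X s t \<in> S X"
proof -
  interpret submonoid "S X" "mon X"
    using assms subfunctor by (simp add: semi_mackey_subfunctor_def)
  show "s \<in> S X \<Longrightarrow> s \<in> mobj M X" "mackey_one G M X \<in> S X"
    "\<lbrakk>s \<in> S X; t \<in> S X\<rbrakk> \<Longrightarrow> mackey_mult G M X s t \<in> S X"
    using subset one_closed m_closed by (auto simp: mon_simps)
qed

lemma
  assumes "X \<in> fin_gsets G" "Y \<in> fin_gsets G" "f \<in> gmaps G X Y"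
  shows denominator_pull: "t \<in> S Y \<Longrightarrow> mpull M X Y f t \<in> S X"
    and denominator_push: "s \<in> S X \<Longrightarrow> mpush M X Y f s \<in> S Y"
  using assms subfunctor unfolding semi_mackey_subfunctor_def by blast+

text \<open>
  Subfunctors are automatically additive: \<open>z\<close> is recovered from its components as
  \<open>i\<^sub>*(i\<^sup>* z) \<cdot> j\<^sub>*(j\<^sup>* z)\<close>, by \<open>push_coproduct\<close> for the identity of \<open>Z\<close>, and a subfunctor is closed under
  push-forwards and products.
\<close>

lemma denominator_coproduct:
  assumes X: "X \<in> fin_gsets G" and Y: "Y \<in> fin_gsets G" and Z: "is_coproduct G X Y Z i j"
    and z: "z \<in> mobj M Z" "mpull M X Z i z \<in> S X" "mpull M Y Z j z \<in> S Y"
  shows "z \<in> S Z"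
proof -
  note finZ = coproduct_gset[OF Z]
  note ij = coproduct_left[OF Z] coproduct_right[OF Z]
  have "z = mackey_mult G M Z (mpush M X Z i (mpull M X Z i z)) (mpush M Y Z j (mpull M Y Z j z))"
    using push_coproduct[OF X Y finZ Z gid_gmaps[OF finZ] z(1)]
    by (simp add: compose_gid_left[OF ij(1)] compose_gid_left[OF ij(2)] push_id[OF finZ z(1)])
  moreover have "\<dots> \<in> S Z"
    using z denominator_push[OF X finZ ij(1)] denominator_push[OF Y finZ ij(2)] denominator_mult[OF finZ] by blast
  ultimately show ?thesis
    by simp
qed

lemma loc_obj: "mobj L X = carrier (fmon X)"
  by (simp add: mackey_loc_def)

lemma fr_in: "\<lbrakk>X \<in> fin_gsets G; x \<in> mobj M X; s \<in> S X\<rbrakk> \<Longrightarrow> fr X x s \<in> mobj L X"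
  using monoid_fractions.frac_in[OF fractions] by (simp add: loc_obj mackey_frac_def mon_simps)

lemma fr_cases:
  assumes "X \<in> fin_gsets G" "c \<in> mobj L X"
  obtains x s where "x \<in> mobj M X" "s \<in> S X" "c = fr X x s"
  using monoid_fractions.frac_cases[OF fractions[OF assms(1)]] assms(2)
  by (metis loc_obj mackey_frac_def mon_simps(1))

lemma fr_eq_iff:
  assumes "X \<in> fin_gsets G" "x \<in> mobj M X" "s \<in> S X" "y \<in> mobj M X" "t \<in> S X"
  shows "fr X x s = fr X y t \<longleftrightarrow> (\<exists>u \<in> S X. mackey_mult G M X u (mackey_mult G M X t x)
     = mackey_mult G M X u (mackey_mult G M X s y))"
  using monoid_fractions.frac_eq_iff[OF fractions[OF assms(1)], of x s y t] assms(2-)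
  by (simp add: mackey_frac_def mon_simps)

lemma pull_fr:
  assumes "X \<in> fin_gsets G" "Y \<in> fin_gsets G" "f \<in> gmaps G X Y" "y \<in> mobj M Y" "t \<in> S Y"
  shows "mpull L X Y f (fr Y y t) = fr X (mpull M X Y f y) (mpull M X Y f t)"
  using monoid_fractions.frac_map[OF fractions[OF assms(2)] fractions[OF assms(1)] pull_hom[OF assms(1-3)]]
    denominator_pull[OF assms(1-3)] assms(4,5)
  by (simp add: mackey_loc_def mackey_frac_def mon_simps image_subset_iff)

lemma push_fr:
  assumes "X \<in> fin_gsets G" "Y \<in> fin_gsets G" "f \<in> gmaps G X Y" "x \<in> mobj M X" "s \<in> S X"
  shows "mpush L X Y f (fr X x s) = fr Y (mpush M X Y f x) (mpush M X Y f s)"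
  using monoid_fractions.frac_map[OF fractions[OF assms(1)] fractions[OF assms(2)] push_hom[OF assms(1-3)]]
    denominator_push[OF assms(1-3)] assms(4,5)
  by (simp add: mackey_loc_def mackey_frac_def mon_simps image_subset_iff)

text \<open>
  Equality of fractions and fractions themselves can be handled on the two summands separately: a
  pair of witnesses \<open>u \<in> S(X)\<close>, \<open>v \<in> S(Y)\<close>, as well as a pair of denominators, comes from a single
  element of \<open>S(Z)\<close>, by \<open>denominator_coproduct\<close>.
\<close>

lemma loc_additive:
  assumes X: "X \<in> fin_gsets G" and Y: "Y \<in> fin_gsets G" and Z: "is_coproduct G X Y Z i j"
  shows "bij_betw (\<lambda>c. (mpull L X Z i c, mpull L Y Z j c)) (mobj L Z) (mobj L X \<times> mobj L Y)"
proof (rule bij_betw_imageI)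
  note finZ = coproduct_gset[OF Z]
  note ij = coproduct_left[OF Z] coproduct_right[OF Z]
  note res = pull_in[OF X finZ ij(1)] pull_in[OF Y finZ ij(2)]
    denominator_pull[OF X finZ ij(1)] denominator_pull[OF Y finZ ij(2)]
  show "inj_on (\<lambda>c. (mpull L X Z i c, mpull L Y Z j c)) (mobj L Z)"
  proof (rule inj_onI)
    fix c c' assume c: "c \<in> mobj L Z" and c': "c' \<in> mobj L Z"
      and eq: "(mpull L X Z i c, mpull L Y Z j c) = (mpull L X Z i c', mpull L Y Z j c')"
    obtain z w where z: "z \<in> mobj M Z" "w \<in> S Z" "c = fr Z z w" using fr_cases[OF finZ c] .
    obtain z' w' where z': "z' \<in> mobj M Z" "w' \<in> S Z" "c' = fr Z z' w'" using fr_cases[OF finZ c'] .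
    note wM = denominator_in[OF finZ z(2)] denominator_in[OF finZ z'(2)]
    let ?a = "mackey_mult G M Z w' z" and ?b = "mackey_mult G M Z w z'"
    have ab: "?a \<in> mobj M Z" "?b \<in> mobj M Z"
      using mult_closed[OF finZ] z(1) z'(1) wM by blast+
    have "\<exists>u \<in> S X. mackey_mult G M X u (mpull M X Z i ?a) = mackey_mult G M X u (mpull M X Z i ?b)"
      using eq z z' wM res by (simp add: pull_fr[OF X finZ ij(1)] fr_eq_iff[OF X] pull_mult[OF X finZ ij(1)])
    then obtain u where u: "u \<in> S X"
      "mackey_mult G M X u (mpull M X Z i ?a) = mackey_mult G M X u (mpull M X Z i ?b)" by blast
    have "\<exists>v \<in> S Y. mackey_mult G M Y v (mpull M Y Z j ?a) = mackey_mult G M Y v (mpull M Y Z j ?b)"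
      using eq z z' wM res by (simp add: pull_fr[OF Y finZ ij(2)] fr_eq_iff[OF Y] pull_mult[OF Y finZ ij(2)])
    then obtain v where v: "v \<in> S Y"
      "mackey_mult G M Y v (mpull M Y Z j ?a) = mackey_mult G M Y v (mpull M Y Z j ?b)" by blast
    obtain r where r: "r \<in> mobj M Z" "mpull M X Z i r = u" "mpull M Y Z j r = v"
      using coproduct_element[OF X Y Z denominator_in[OF X u(1)] denominator_in[OF Y v(1)]] .
    have "mackey_mult G M Z r ?a = mackey_mult G M Z r ?b"
      by (rule coproduct_element_eqI[OF X Y Z])
         (use r ab u v in \<open>simp_all add: mult_closed[OF finZ] pull_mult[OF X finZ ij(1) r(1)] pull_mult[OF Y finZ ij(2) r(1)]\<close>)
    moreover have "r \<in> S Z"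
      using denominator_coproduct[OF X Y Z r(1)] r u(1) v(1) by simp
    ultimately show "c = c'"
      using z z' by (auto simp: fr_eq_iff[OF finZ])
  qed
  show "(\<lambda>c. (mpull L X Z i c, mpull L Y Z j c)) ` mobj L Z = mobj L X \<times> mobj L Y"
  proof (intro equalityI subsetI)
    fix p assume "p \<in> (\<lambda>c. (mpull L X Z i c, mpull L Y Z j c)) ` mobj L Z"
    then obtain c where c: "c \<in> mobj L Z" "p = (mpull L X Z i c, mpull L Y Z j c)" by blast
    obtain z w where z: "z \<in> mobj M Z" "w \<in> S Z" "c = fr Z z w" using fr_cases[OF finZ c(1)] .
    show "p \<in> mobj L X \<times> mobj L Y"
      using c(2) z res by (simp add: pull_fr[OF X finZ ij(1)] pull_fr[OF Y finZ ij(2)] fr_in[OF X] fr_in[OF Y])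
  next
    fix p assume "p \<in> mobj L X \<times> mobj L Y"
    then obtain a b where p: "p = (a, b)" "a \<in> mobj L X" "b \<in> mobj L Y" by blast
    obtain x s where x: "x \<in> mobj M X" "s \<in> S X" "a = fr X x s" using fr_cases[OF X p(2)] .
    obtain y t where y: "y \<in> mobj M Y" "t \<in> S Y" "b = fr Y y t" using fr_cases[OF Y p(3)] .
    obtain z where z: "z \<in> mobj M Z" "mpull M X Z i z = x" "mpull M Y Z j z = y"
      using coproduct_element[OF X Y Z x(1) y(1)] .
    obtain w where w: "w \<in> mobj M Z" "mpull M X Z i w = s" "mpull M Y Z j w = t"
      using coproduct_element[OF X Y Z denominator_in[OF X x(2)] denominator_in[OF Y y(2)]] .
    have wS: "w \<in> S Z"
      using denominator_coproduct[OF X Y Z w(1)] w x(2) y(2) by simp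
    have "p = (mpull L X Z i (fr Z z w), mpull L Y Z j (fr Z z w))"
      using p x y z w wS by (simp add: pull_fr[OF X finZ ij(1)] pull_fr[OF Y finZ ij(2)])
    then show "p \<in> (\<lambda>c. (mpull L X Z i c, mpull L Y Z j c)) ` mobj L Z"
      using fr_in[OF finZ z(1) wS] by blast
  qed
qed

lemma loc_semi_mackey: "semi_mackey_functor G L"
proof
  fix X Y :: "('g, 'u) gset" and f assume X: "X \<in> fin_gsets G" and Y: "Y \<in> fin_gsets G" and f: "f \<in> gmaps G X Y"
  show "mpull L X Y f \<in> mobj L Y \<rightarrow> mobj L X"
  proof
    fix c assume "c \<in> mobj L Y"
    then obtain y t where "y \<in> mobj M Y" "t \<in> S Y" "c = fr Y y t" using fr_cases[OF Y] by metis
    then show "mpull L X Y f c \<in> mobj L X"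
      by (simp add: pull_fr[OF X Y f] fr_in[OF X] pull_in[OF X Y f] denominator_pull[OF X Y f])
  qed
  show "mpush L X Y f \<in> mobj L X \<rightarrow> mobj L Y"
  proof
    fix c assume "c \<in> mobj L X"
    then obtain x s where "x \<in> mobj M X" "s \<in> S X" "c = fr X x s" using fr_cases[OF X] by metis
    then show "mpush L X Y f c \<in> mobj L Y"
      by (simp add: push_fr[OF X Y f] fr_in[OF Y] push_in[OF X Y f] denominator_push[OF X Y f])
  qed
next
  fix X c assume X: "X \<in> fin_gsets G" and "c \<in> mobj L X"
  then obtain x s where c: "x \<in> mobj M X" "s \<in> S X" "c = fr X x s" using fr_cases[OF X] by metis
  show "mpull L X X (gid X) c = c"
    using c by (simp add: pull_fr[OF X X gid_gmaps[OF X]] pull_id[OF X] denominator_in[OF X])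
  show "mpush L X X (gid X) c = c"
    using c by (simp add: push_fr[OF X X gid_gmaps[OF X]] push_id[OF X] denominator_in[OF X])
next
  fix X Y Z :: "('g, 'u) gset" and f g c
  assume X: "X \<in> fin_gsets G" and Y: "Y \<in> fin_gsets G" and Z: "Z \<in> fin_gsets G"
    and f: "f \<in> gmaps G X Y" and g: "g \<in> gmaps G Y Z" and "c \<in> mobj L Z"
  then obtain z w where c: "z \<in> mobj M Z" "w \<in> S Z" "c = fr Z z w" using fr_cases[OF Z] by metis
  show "mpull L X Z (compose (points X) g f) c = mpull L X Y f (mpull L Y Z g c)"
    using c by (simp add: pull_fr[OF X Z gmaps_compose[OF X f g]] pull_fr[OF Y Z g] pull_fr[OF X Y f]
        pull_in[OF Y Z g] denominator_pull[OF Y Z g] pull_comp[OF X Y Z f g] denominator_in[OF Z])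
next
  fix X Y Z :: "('g, 'u) gset" and f g c
  assume X: "X \<in> fin_gsets G" and Y: "Y \<in> fin_gsets G" and Z: "Z \<in> fin_gsets G"
    and f: "f \<in> gmaps G X Y" and g: "g \<in> gmaps G Y Z" and "c \<in> mobj L X"
  then obtain x s where c: "x \<in> mobj M X" "s \<in> S X" "c = fr X x s" using fr_cases[OF X] by metis
  show "mpush L X Z (compose (points X) g f) c = mpush L Y Z g (mpush L X Y f c)"
    using c by (simp add: push_fr[OF X Z gmaps_compose[OF X f g]] push_fr[OF Y Z g] push_fr[OF X Y f]
        push_in[OF X Y f] denominator_push[OF X Y f] push_comp[OF X Y Z f g] denominator_in[OF X])
next
  fix X Y Z :: "('g, 'u) gset" and i j
  assume "X \<in> fin_gsets G" "Y \<in> fin_gsets G" "is_coproduct G X Y Z i j"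
  then show "bij_betw (\<lambda>z. (mpull L X Z i z, mpull L Y Z j z)) (mobj L Z) (mobj L X \<times> mobj L Y)"
    by (rule loc_additive)
next
  obtain e where e: "e \<in> mobj M (gempty G)" "\<And>e'. e' \<in> mobj M (gempty G) \<Longrightarrow> e' = e"
    using empty_element by metis
  have unique: "s = e" if "s \<in> S (gempty G)" for s
    using e(2) denominator_in[OF gempty_fin_gset that] .
  have eS: "e \<in> S (gempty G)"
    using unique denominator_one[OF gempty_fin_gset] by metis
  show "\<exists>!c. c \<in> mobj L (gempty G)"
  proof (rule ex1I[of _ "fr (gempty G) e e"])
    show "fr (gempty G) e e \<in> mobj L (gempty G)"
      using fr_in[OF gempty_fin_gset e(1) eS] .
    show "c = fr (gempty G) e e" if "c \<in> mobj L (gempty G)" for c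
      using fr_cases[OF gempty_fin_gset that] e(2) unique by metis
  qed
next
  fix X Y X' Y' :: "('g, 'u) gset" and f \<eta> \<xi> f' c
  assume pb: "is_pullback G X Y X' Y' f \<eta> \<xi> f'" and "c \<in> mobj L Y'"
  have X: "X \<in> fin_gsets G" and Y: "Y \<in> fin_gsets G" and X': "X' \<in> fin_gsets G" and Y': "Y' \<in> fin_gsets G"
    and f: "f \<in> gmaps G X Y" and \<eta>: "\<eta> \<in> gmaps G Y' Y" and \<xi>: "\<xi> \<in> gmaps G X' X" and f': "f' \<in> gmaps G X' Y'"
    using pb by (simp_all add: is_pullback_def)
  obtain y t where c: "y \<in> mobj M Y'" "t \<in> S Y'" "c = fr Y' y t" using fr_cases[OF Y' \<open>c \<in> mobj L Y'\<close>] .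
  show "mpull L X Y f (mpush L Y' Y \<eta> c) = mpush L X' X \<xi> (mpull L X' Y' f' c)"
    using c by (simp add: push_fr[OF Y' Y \<eta>] pull_fr[OF X Y f] pull_fr[OF X' Y' f'] push_fr[OF X' X \<xi>]
        push_in[OF Y' Y \<eta>] denominator_push[OF Y' Y \<eta>] pull_in[OF X' Y' f'] denominator_pull[OF X' Y' f']
        mackey[OF pb] denominator_in[OF Y'])
qed

sublocale loc: group_semi_mackey G L
  using loc_semi_mackey by (intro group_semi_mackey.intro is_group)

text \<open>
  Numerators and denominators are lifted separately to \<open>X \<amalg> X\<close>; the push-forward of the resulting
  fraction along the codiagonal is the fraction of the two products.
\<close>

lemma loc_mult:
  assumes X: "X \<in> fin_gsets G" and x: "x \<in> mobj M X" "s \<in> S X" and y: "y \<in> mobj M X" "t \<in> S X"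
  shows "mackey_mult G L X (fr X x s) (fr X y t) = fr X (mackey_mult G M X x y) (mackey_mult G M X s t)"
proof -
  obtain Z i j h z where Z: "is_coproduct G X X Z i j" and h: "h \<in> gmaps G Z X"
      "compose (points X) h i = gid X" "compose (points X) h j = gid X"
    and z: "z \<in> mobj M Z" "mpull M X Z i z = x" "mpull M X Z j z = y"
    and xy: "mackey_mult G M X x y = mpush M Z X h z"
    using mult_witness[OF X x(1) y(1)] .
  note finZ = coproduct_gset[OF Z]
  note ij = coproduct_left[OF Z] coproduct_right[OF Z]
  obtain w where w: "w \<in> mobj M Z" "mpull M X Z i w = s" "mpull M X Z j w = t"
    using coproduct_element[OF X X Z denominator_in[OF X x(2)] denominator_in[OF X y(2)]] .
  have wS: "w \<in> S Z"
    using denominator_coproduct[OF X X Z w(1)] w x(2) y(2) by simp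
  show ?thesis
    using loc.mult_eq_push_fold[OF X Z fr_in[OF finZ z(1) wS] h] mult_eq_push_fold[OF X Z w(1) h]
    by (simp add: pull_fr[OF X finZ ij(1) z(1) wS] pull_fr[OF X finZ ij(2) z(1) wS]
        push_fr[OF finZ X h(1) z(1) wS] z w xy)
qed

lemma loc_one:
  assumes X: "X \<in> fin_gsets G"
  shows "mackey_one G L X = fr X (mackey_one G M X) (mackey_one G M X)"
proof -
  obtain e where e: "e \<in> mobj M (gempty G)" "\<And>e'. e' \<in> mobj M (gempty G) \<Longrightarrow> e' = e"
    "\<And>X. mackey_one G M X = mpush M (gempty G) X (\<lambda>x \<in> {}. x) e"
    using empty_element by metis
  have eS: "e \<in> S (gempty G)"
    using e(2) one_closed[OF gempty_fin_gset] denominator_one[OF gempty_fin_gset] by metis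
  have "mackey_one G L X = mpush L (gempty G) X (\<lambda>x \<in> {}. x) (fr (gempty G) e e)"
    using loc.empty_element fr_in[OF gempty_fin_gset e(1) eS] by metis
  then show ?thesis
    by (simp add: push_fr[OF gempty_fin_gset X gempty_gmaps e(1) eS] e(3))
qed

text \<open>
  The two multiplications are functions on the whole type that may differ off the carrier, so the
  monoid records are compared on the carrier only; for homomorphisms this makes no difference.
\<close>

lemma loc_monoid:
  assumes X: "X \<in> fin_gsets G"
  shows "carrier (loc.mon X) = carrier (fmon X)" and "\<one>\<^bsub>loc.mon X\<^esub> = \<one>\<^bsub>fmon X\<^esub>"
    and "\<lbrakk>a \<in> carrier (fmon X); b \<in> carrier (fmon X)\<rbrakk> \<Longrightarrow> a \<otimes>\<^bsub>loc.mon X\<^esub> b = a \<otimes>\<^bsub>fmon X\<^esub> b"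
proof -
  show "carrier (loc.mon X) = carrier (fmon X)"
    by (simp add: loc.mon_simps loc_obj)
  show "\<one>\<^bsub>loc.mon X\<^esub> = \<one>\<^bsub>fmon X\<^esub>"
    using monoid_fractions.frac_one[OF fractions[OF X]]
    by (simp add: loc.mon_simps loc_one[OF X] mackey_frac_def mon_simps)
  assume "a \<in> carrier (fmon X)" "b \<in> carrier (fmon X)"
  then have a: "a \<in> mobj L X" and b: "b \<in> mobj L X"
    by (simp_all add: loc_obj)
  obtain x s where x: "x \<in> mobj M X" "s \<in> S X" "a = fr X x s" using fr_cases[OF X a] .
  obtain y t where y: "y \<in> mobj M X" "t \<in> S X" "b = fr X y t" using fr_cases[OF X b] .
  show "a \<otimes>\<^bsub>loc.mon X\<^esub> b = a \<otimes>\<^bsub>fmon X\<^esub> b"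
    unfolding x(3) y(3) loc.mon_simps(2) loc_mult[OF X x(1,2) y(1,2)]
    using x y monoid_fractions.frac_mult[OF fractions[OF X], of x s y t]
    by (simp add: mackey_frac_def mon_simps)
qed

lemma hom_loc:
  assumes X: "X \<in> fin_gsets G"
  shows hom_from_loc: "hom (loc.mon X) C = hom (fmon X) C"
    and hom_to_loc: "hom B (loc.mon X) = hom B (fmon X)"
    and monoid_homs_from_loc: "monoid_homs (loc.mon X) C = monoid_homs (fmon X) C"
proof -
  interpret FX: comm_monoid "fmon X"
    using monoid_fractions.frac_comm_monoid[OF fractions[OF X]] .
  show from_loc: "hom (loc.mon X) C = hom (fmon X) C" for C
    by (auto simp: hom_def loc_monoid[OF X])
  show "hom B (loc.mon X) = hom B (fmon X)"
    by (auto simp: hom_def loc_monoid[OF X] Pi_iff)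
  show "monoid_homs (loc.mon X) C = monoid_homs (fmon X) C"
    by (simp add: monoid_homs_def from_loc loc_monoid[OF X])
qed

lemma loc_map_apply:
  "\<lbrakk>X \<in> fin_gsets G; x \<in> mobj M X\<rbrakk> \<Longrightarrow> loc_map G M S X x = fr X x (mackey_one G M X)"
  by (simp add: loc_map_def)

lemma loc_map_smack: "loc_map G M S \<in> smack G M L"
proof -
  have "loc_map G M S X \<in> monoid_homs (mon X) (loc.mon X)" if X: "X \<in> fin_gsets G" for X
  proof -
    have "loc_map G M S X \<in> hom (mon X) (fmon X)"
      using monoid_fractions.frac_numerator_hom[OF fractions[OF X]] mult_closed[OF X] X
      by (simp add: hom_def mon_simps loc_map_def mackey_frac_def Pi_iff)
    then show ?thesis
      using X one_closed[OF X]
      by (simp add: monoid_homs_def hom_to_loc[OF X] mon_simps loc_map_apply loc.mon_simps loc_one)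
         (simp add: loc_map_def)
  qed
  moreover have "loc_map G M S \<in> extensional (fin_gsets G)"
    by (simp add: loc_map_def)
  moreover have "loc_map G M S X (mpull M X Y f y) = mpull L X Y f (loc_map G M S Y y)"
    if "X \<in> fin_gsets G" "Y \<in> fin_gsets G" "f \<in> gmaps G X Y" "y \<in> mobj M Y" for X Y f y
    using that by (simp add: loc_map_apply pull_fr pull_in denominator_one pull_one)
  moreover have "loc_map G M S Y (mpush M X Y f x) = mpush L X Y f (loc_map G M S X x)"
    if "X \<in> fin_gsets G" "Y \<in> fin_gsets G" "f \<in> gmaps G X Y" "x \<in> mobj M X" for X Y f x
    using that by (simp add: loc_map_apply push_fr push_in denominator_one push_one)
  ultimately show ?thesis
    by (simp add: smack_def PiE_def Pi_def)
qed

lemma loc_map_Units: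
  assumes "X \<in> fin_gsets G" "s \<in> S X"
  shows "loc_map G M S X s \<in> Units (loc.mon X)"
proof -
  have "loc_map G M S X s \<in> Units (fmon X)"
    using monoid_fractions.frac_denominator_Units[OF fractions] assms
    by (simp add: loc_map_apply denominator_in mackey_frac_def mon_simps)
  then show ?thesis
    using loc_monoid[OF assms(1)] by (auto simp: Units_def)
qed

lemma loc_hom_unique:
  assumes X: "X \<in> fin_gsets G" and C: "comm_monoid C"
    and hom: "\<psi> \<in> hom (loc.mon X) C" "\<psi>' \<in> hom (loc.mon X) C"
    and units: "\<And>s. s \<in> S X \<Longrightarrow> \<psi> (loc_map G M S X s) \<in> Units C"
    and eq: "\<And>x. x \<in> mobj M X \<Longrightarrow> \<psi> (loc_map G M S X x) = \<psi>' (loc_map G M S X x)"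
    and c: "c \<in> mobj L X"
  shows "\<psi> c = \<psi>' c"
  using monoid_fractions.frac_hom_unique[OF fractions[OF X] C, of \<psi> \<psi>' c] hom units eq c denominator_in[OF X]
  by (simp add: hom_from_loc[OF X] loc_map_apply[OF X] mackey_frac_def mon_simps loc_obj)

text \<open>
  The extensions \<open>\<psi>\<^sub>X\<close> come from the universal property of fractions of monoids, separately for each
  \<open>X\<close>. They commute with restrictions and push-forwards because the two composites around each
  square are homomorphisms that agree on the fractions \<open>x / 1\<close>.
\<close>

lemma smack_extend:
  fixes N :: "('g, 'u, 'n) mackey_data"
  assumes "semi_mackey_functor G N" and \<theta>: "\<theta> \<in> smack G M N"
    and units: "\<And>X. X \<in> fin_gsets G \<Longrightarrow> \<theta> X ` S X \<subseteq> mackey_units G N X"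
  obtains \<psi> where "\<psi> \<in> smack G L N" "smack_comp G M \<psi> (loc_map G M S) = \<theta>"
proof -
  interpret N: group_semi_mackey G N
    using assms(1) by (intro group_semi_mackey.intro is_group)
  have "\<exists>p. p \<in> monoid_homs (loc.mon X) (N.mon X) \<and> (\<forall>x \<in> mobj M X. p (loc_map G M S X x) = \<theta> X x)"
    if X: "X \<in> fin_gsets G" for X
    using monoid_fractions.frac_hom_exists[OF fractions[OF X] N.mon_comm_monoid[OF X] smack_hom[OF \<theta> X]]
      smack_one[OF \<theta> X] units[OF X] loc_map_apply[OF X]
    by (metis mackey_frac_def mackey_units_def mon_simps(1,3) N.mon_simps(3) monoid_homs_from_loc[OF X])
  then obtain p where p: "\<And>X. X \<in> fin_gsets G \<Longrightarrow> p X \<in> monoid_homs (loc.mon X) (N.mon X)"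
    "\<And>X x. \<lbrakk>X \<in> fin_gsets G; x \<in> mobj M X\<rbrakk> \<Longrightarrow> p X (loc_map G M S X x) = \<theta> X x"
    by metis
  define \<psi> where "\<psi> = restrict p (fin_gsets G)"
  have psi: "\<psi> X \<in> monoid_homs (loc.mon X) (N.mon X)" if "X \<in> fin_gsets G" for X
    using p(1) that by (simp add: \<psi>_def)
  have psi_hom: "\<psi> X \<in> hom (loc.mon X) (N.mon X)" if "X \<in> fin_gsets G" for X
    using psi[OF that] by (simp add: monoid_homs_def)
  have psi_loc: "\<psi> X (loc_map G M S X x) = \<theta> X x" if "X \<in> fin_gsets G" "x \<in> mobj M X" for X x
    using p(2) that by (simp add: \<psi>_def)
  have unit: "\<theta> X s \<in> Units (N.mon X)" if "X \<in> fin_gsets G" "s \<in> S X" for X s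
    using units[OF that(1)] that(2) by (auto simp: mackey_units_def)
  have pull: "\<psi> X (mpull L X Y f c) = mpull N X Y f (\<psi> Y c)"
    if X: "X \<in> fin_gsets G" and Y: "Y \<in> fin_gsets G" and f: "f \<in> gmaps G X Y" and c: "c \<in> mobj L Y" for X Y f c
  proof -
    have num: "\<psi> X (mpull L X Y f (loc_map G M S Y y)) = \<theta> X (mpull M X Y f y)" if "y \<in> mobj M Y" for y
      using smack_pull[OF loc_map_smack X Y f that] psi_loc[OF X pull_in[OF X Y f that]] by simp
    show ?thesis
      using loc_hom_unique[OF Y N.mon_comm_monoid[OF X] Group.hom_compose[OF loc.pull_hom[OF X Y f] psi_hom[OF X]]
          Group.hom_compose[OF psi_hom[OF Y] N.pull_hom[OF X Y f]] _ _ c]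
        num denominator_in[OF Y] unit[OF X denominator_pull[OF X Y f]] psi_loc[OF Y] smack_pull[OF \<theta> X Y f]
      by simp
  qed
  have push: "\<psi> Y (mpush L X Y f c) = mpush N X Y f (\<psi> X c)"
    if X: "X \<in> fin_gsets G" and Y: "Y \<in> fin_gsets G" and f: "f \<in> gmaps G X Y" and c: "c \<in> mobj L X" for X Y f c
  proof -
    have num: "\<psi> Y (mpush L X Y f (loc_map G M S X x)) = \<theta> Y (mpush M X Y f x)" if "x \<in> mobj M X" for x
      using smack_push[OF loc_map_smack X Y f that] psi_loc[OF Y push_in[OF X Y f that]] by simp
    show ?thesis
      using loc_hom_unique[OF X N.mon_comm_monoid[OF Y] Group.hom_compose[OF loc.push_hom[OF X Y f] psi_hom[OF Y]]
          Group.hom_compose[OF psi_hom[OF X] N.push_hom[OF X Y f]] _ _ c]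
        num denominator_in[OF X] unit[OF Y denominator_push[OF X Y f]] psi_loc[OF X] smack_push[OF \<theta> X Y f]
      by simp
  qed
  have smack: "\<psi> \<in> smack G L N"
    using psi pull push by (simp add: smack_def PiE_def Pi_def) (simp add: \<psi>_def)
  moreover have "smack_comp G M \<psi> (loc_map G M S) = \<theta>"
    using psi_loc by (intro smack_eqI[OF smack_compose[OF loc_map_smack smack] \<theta>]) (simp add: smack_comp_apply)
  ultimately show ?thesis
    using that by blast
qed

lemma loc_universal:
  fixes N :: "('g, 'u, 'n) mackey_data"
  assumes N: "semi_mackey_functor G N"
  shows "bij_betw (\<lambda>\<psi>. smack_comp G M \<psi> (loc_map G M S)) (smack G L N)
    {\<theta> \<in> smack G M N. \<forall>X \<in> fin_gsets G. \<theta> X ` S X \<subseteq> mackey_units G N X}"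
proof (rule bij_betw_imageI)
  interpret N: group_semi_mackey G N
    using N by (intro group_semi_mackey.intro is_group)
  have units: "\<psi> X (loc_map G M S X s) \<in> Units (N.mon X)"
    if "\<psi> \<in> smack G L N" "X \<in> fin_gsets G" "s \<in> S X" for \<psi> X s
    using hom_Units[OF smack_hom[OF that(1,2)] _ loc_map_Units[OF that(2,3)]] smack_one[OF that(1,2)]
    by (simp add: loc.mon_simps N.mon_simps)
  show "inj_on (\<lambda>\<psi>. smack_comp G M \<psi> (loc_map G M S)) (smack G L N)"
  proof (rule inj_onI, rule smack_eqI)
    fix \<psi> \<psi>' X c
    assume \<psi>: "\<psi> \<in> smack G L N" and \<psi>': "\<psi>' \<in> smack G L N"
      and eq: "smack_comp G M \<psi> (loc_map G M S) = smack_comp G M \<psi>' (loc_map G M S)"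
      and X: "X \<in> fin_gsets G" and c: "c \<in> mobj L X"
    show "\<psi> X c = \<psi>' X c"
    proof (rule loc_hom_unique[OF X N.mon_comm_monoid[OF X] smack_hom[OF \<psi> X] smack_hom[OF \<psi>' X] units[OF \<psi> X] _ c])
      show "\<psi> X (loc_map G M S X x) = \<psi>' X (loc_map G M S X x)" if "x \<in> mobj M X" for x
        using fun_cong[OF fun_cong[OF eq, of X], of x] X that by (simp add: smack_comp_apply)
    qed
  qed
  show "(\<lambda>\<psi>. smack_comp G M \<psi> (loc_map G M S)) ` smack G L N
    = {\<theta> \<in> smack G M N. \<forall>X \<in> fin_gsets G. \<theta> X ` S X \<subseteq> mackey_units G N X}"
  proof (intro equalityI subsetI)
    fix \<theta> assume "\<theta> \<in> (\<lambda>\<psi>. smack_comp G M \<psi> (loc_map G M S)) ` smack G L N"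
    then obtain \<psi> where \<psi>: "\<psi> \<in> smack G L N" "\<theta> = smack_comp G M \<psi> (loc_map G M S)" by blast
    then show "\<theta> \<in> {\<theta> \<in> smack G M N. \<forall>X \<in> fin_gsets G. \<theta> X ` S X \<subseteq> mackey_units G N X}"
      using smack_compose[OF loc_map_smack \<psi>(1)] units[OF \<psi>(1)]
      by (auto simp: smack_comp_apply denominator_in mackey_units_def)
  next
    fix \<theta> assume "\<theta> \<in> {\<theta> \<in> smack G M N. \<forall>X \<in> fin_gsets G. \<theta> X ` S X \<subseteq> mackey_units G N X}"
    then obtain \<psi> where "\<psi> \<in> smack G L N" "smack_comp G M \<psi> (loc_map G M S) = \<theta>"
      using smack_extend[OF N, of \<theta>] by auto
    then show "\<theta> \<in> (\<lambda>\<psi>. smack_comp G M \<psi> (loc_map G M S)) ` smack G L N"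
      by blast
  qed
qed

end

section \<open>The localization theorem\<close>

theorem proposition2p3:
  fixes G :: "('g, 'b) monoid_scheme"
    and M :: "('g, 'u::infinite, 'm) mackey_data"
    and S :: "('g, 'u) gset \<Rightarrow> 'm set"
  assumes "group G" and "finite (carrier G)"
    and "semi_mackey_functor G M"
    and "semi_mackey_subfunctor G S M"
  shows
    "(semi_mackey_functor G (mackey_loc G M S)
      \<and> (\<forall>X \<in> fin_gsets G.
           let L = mackey_monoid G (mackey_loc G M S) X;
               F = frac_monoid (mackey_monoid G M X) (S X)
           in comm_monoid F \<and> carrier L = carrier F \<and> \<one>\<^bsub>L\<^esub> = \<one>\<^bsub>F\<^esub>
              \<and> (\<forall>a \<in> carrier F. \<forall>b \<in> carrier F. a \<otimes>\<^bsub>L\<^esub> b = a \<otimes>\<^bsub>F\<^esub> b))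
      \<and> (\<forall>X \<in> fin_gsets G. \<forall>Y \<in> fin_gsets G. \<forall>f \<in> gmaps G X Y.
           (\<forall>y \<in> mobj M Y. \<forall>t \<in> S Y.
              mpull (mackey_loc G M S) X Y f (mackey_frac G M S Y y t)
                = mackey_frac G M S X (mpull M X Y f y) (mpull M X Y f t))
           \<and> (\<forall>x \<in> mobj M X. \<forall>s \<in> S X.
              mpush (mackey_loc G M S) X Y f (mackey_frac G M S X x s)
                = mackey_frac G M S Y (mpush M X Y f x) (mpush M X Y f s))))
     \<and> loc_map G M S \<in> smack G M (mackey_loc G M S)
     \<and> (\<forall>M' :: ('g, 'u, 'n) mackey_data. semi_mackey_functor G M' \<longrightarrow>
          bij_betw (\<lambda>\<psi>. smack_comp G M \<psi> (loc_map G M S))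
            (smack G (mackey_loc G M S) M')
            {\<theta> \<in> smack G M M'. \<forall>X \<in> fin_gsets G. \<theta> X ` S X \<subseteq> mackey_units G M' X})"
proof -
  interpret mackey_fractions G M S
    using assms(1,3,4)
    by (simp add: mackey_fractions_def mackey_fractions_axioms_def group_semi_mackey_def)
  show ?thesis
    unfolding Let_def
  proof (intro conjI ballI allI impI)
    show "comm_monoid (fmon X)" if "X \<in> fin_gsets G" for X
      using monoid_fractions.frac_comm_monoid[OF fractions[OF that]] .
  qed (fact loc_semi_mackey loc_monoid pull_fr push_fr loc_map_smack loc_universal)+
qed

end
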